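(* There exists no isometry between the quaternionic Poincaré distance $\delta_\Delta$ and the Kobayashi distance of $\Delta_{\mathbb{H}}\cong\Delta_{\mathbb{C}^2}$; that is, the metric space $\Delta_{\mathbb{H}}$ with $\delta_\Delta$ and the metric space $\Delta_{\mathbb{C}^2}$ with its Kobayashi distance are not isometric.
   Context: $\mathbb{H}\cong\mathbb{R}^4$ is the skew field of real quaternions, $\Delta_{\mathbb{H}}=\{q\in\mathbb{H}:|q|<1\}$, identified with the open unit ball $\Delta_{\mathbb{C}^2}$ of $\mathbb{C}^2$ via $\mathbb{H}=\mathbb{C}+\mathbb{C}j$. The Kobayashi distance of $\Delta_{\mathbb{C}^2}$ is the standard one, normalized so that on the unit disc $\mathbb{D}\subset\mathbb{C}$ it equals the Poincaré distance with $\delta_{\mathbb{D}}(0,z)=\frac12\log\frac{1+|z|}{1-|z|}$. The cross-ratio is $\mathcal{CR}(q_1,q_2,q_3,q_4)=(q_1-q_3)(q_1-q_4)^{-1}(q_2-q_4)(q_2-q_3)^{-1}$. The non-Euclidean line through $q_1\ne q_2\in\Delta_{\mathbb{H}}$ is the diameter of $\Delta_{\mathbb{H}}$ containing them if $q_1,q_2$ are $\mathbb{R}$-linearly dependent, and otherwise the unique circle through $q_1,q_2$ that intersects $\partial\Delta_{\mathbb{H}}$ orthogonally; its two ends are its intersection points with $\partial\Delta_{\mathbb{H}}$. The quaternionic Poincaré distance is $\delta_\Delta(q_1,q_2)=\frac12\log\big(\mathcal{CR}(q_1,q_2,q_3,q_4)\big)$, where $q_3,q_4$ are the ends of the non-Euclidean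 line through $q_1,q_2$, named so that $q_1,q_2,q_3,q_4$ are arranged cyclically on it (for example, $\delta_\Delta(0,t)=\frac12\log\mathcal{CR}(0,t,1,-1)$ for $0<t<1$); and $\delta_\Delta(q,q)=0$. *)

theory Defs
  imports "HOL-Complex_Analysis.Complex_Analysis"
begin

section \<open>The quaternions as \<open>\<complex> + \<complex>j\<close>\<close>

text \<open>\<open>Quat a b\<close> stands for \<open>a + bj\<close>. Products are determined by \<open>j\<^sup>2 = -1\<close> and
  \<open>jc = (cnj c) j\<close> for complex \<open>c\<close>.\<close>

datatype quat = Quat (cpart: complex) (jpart: complex)

lemma quat_eq_iff: "p = q \<longleftrightarrow> cpart p = cpart q \<and> jpart p = jpart q"
  by (auto intro: quat.expand)

instantiation quat :: real_inner
begin

definition "0 = Quat 0 0"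
definition "p + q = Quat (cpart p + cpart q) (jpart p + jpart q)"
definition "p - q = Quat (cpart p - cpart q) (jpart p - jpart q)"
definition "- p = Quat (- cpart p) (- jpart p)"
definition "r *\<^sub>R p = Quat (r *\<^sub>R cpart p) (r *\<^sub>R jpart p)"
definition "p \<bullet> q = cpart p \<bullet> cpart q + jpart p \<bullet> jpart q" for p q :: quat
definition "norm p = sqrt (p \<bullet> p)" for p :: quat
definition "sgn p = inverse (norm p) *\<^sub>R p" for p :: quat
definition "dist p q = norm (p - q)" for p q :: quat
definition [code del]: "(uniformity :: (quat \<times> quat) filter) =
  (INF e\<in>{0 <..}. principal {(x, y). dist x y < e})"
definition [code del]: "open (U :: quat set) \<longleftrightarrow>
  (\<forall>x\<in>U. eventually (\<lambda>(x', y). x' = x \<longrightarrow> y \<in> U) uniformity)"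

lemma quat_sel [simp]:
  "cpart 0 = 0" "jpart 0 = 0"
  "cpart (p + q) = cpart p + cpart q" "jpart (p + q) = jpart p + jpart q"
  "cpart (p - q) = cpart p - cpart q" "jpart (p - q) = jpart p - jpart q"
  "cpart (- p) = - cpart p" "jpart (- p) = - jpart p"
  "cpart (r *\<^sub>R p) = r *\<^sub>R cpart p" "jpart (r *\<^sub>R p) = r *\<^sub>R jpart p"
  by (simp_all add: zero_quat_def plus_quat_def minus_quat_def uminus_quat_def scaleR_quat_def)

instance
proof
  fix x y z :: quat and a b :: real
  show "0 \<le> x \<bullet> x" by (simp add: inner_quat_def)
  show "(x \<bullet> x = 0) = (x = 0)"
    by (simp add: inner_quat_def quat_eq_iff add_nonneg_eq_0_iff)
qed (auto simp: quat_eq_iff inner_quat_def norm_quat_def sgn_quat_def dist_quat_def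
      uniformity_quat_def open_quat_def algebra_simps inner_commute)

end

instantiation quat :: real_normed_div_algebra
begin

definition "1 = Quat 1 0"
definition "p * q = Quat (cpart p * cpart q - jpart p * cnj (jpart q))
                         (cpart p * jpart q + jpart p * cnj (cpart q))"
definition "inverse q = Quat (cnj (cpart q) / of_real ((norm q)\<^sup>2)) (- jpart q / of_real ((norm q)\<^sup>2))"
definition "p div q = p * inverse q" for p q :: quat

lemma quat_mult_sel [simp]:
  "cpart 1 = 1" "jpart 1 = 0"
  "cpart (p * q) = cpart p * cpart q - jpart p * cnj (jpart q)"
  "jpart (p * q) = cpart p * jpart q + jpart p * cnj (cpart q)"
  by (simp_all add: one_quat_def times_quat_def)

lemma norm_quat_squared: "(norm q)\<^sup>2 = (cmod (cpart q))\<^sup>2 + (cmod (jpart q))\<^sup>2"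
  by (simp add: norm_quat_def inner_quat_def power2_norm_eq_inner)

instance
proof
  fix x y z :: quat and a :: real
  show "x * y * z = x * (y * z)" "(x + y) * z = x * z + y * z" "x * (y + z) = x * y + x * z"
    "1 * x = x" "x * 1 = x" "(0::quat) \<noteq> 1" "x div y = x * inverse y"
    "a *\<^sub>R x * y = a *\<^sub>R (x * y)" "x * a *\<^sub>R y = a *\<^sub>R (x * y)"
    by (auto simp: quat_eq_iff divide_quat_def algebra_simps scaleR_conv_of_real)
  show "inverse (0::quat) = 0"
    by (simp add: inverse_quat_def zero_quat_def)
  have n: "complex_of_real ((norm x)\<^sup>2) = cpart x * cnj (cpart x) + jpart x * cnj (jpart x)"
    by (simp only: norm_quat_squared of_real_add complex_norm_square)
  assume "x \<noteq> 0"
  then have "complex_of_real ((norm x)\<^sup>2) \<noteq> 0" by simp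
  then show "inverse x * x = 1" "x * inverse x = 1"
    using n by (simp_all add: quat_eq_iff inverse_quat_def mult.commute
        flip: add_divide_distrib diff_divide_distrib del: of_real_power)
next
  fix x y :: quat
  have "(norm (x * y))\<^sup>2 = (norm x * norm y)\<^sup>2"
    unfolding power_mult_distrib norm_quat_squared cmod_power2
    by (simp, algebra)
  then show "norm (x * y) = norm x * norm y"
    by (simp add: power2_eq_iff_nonneg)
qed

end

instantiation quat :: euclidean_space
begin

definition "Basis = {Quat 1 0, Quat \<i> 0, Quat 0 1, Quat 0 \<i>}"

instance
proof
  show "(\<forall>u\<in>Basis. x \<bullet> u = 0) \<longleftrightarrow> x = 0" for x :: quat
    by (simp add: Basis_quat_def inner_quat_def inner_complex_def quat_eq_iff[of x 0] complex_eq_iff)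
qed (auto simp: Basis_quat_def inner_quat_def inner_complex_def)

end


section \<open>The quaternionic Poincare distance\<close>

definition cross_ratio :: "quat \<Rightarrow> quat \<Rightarrow> quat \<Rightarrow> quat \<Rightarrow> quat" where
  "cross_ratio q1 q2 q3 q4 = (q1 - q3) * inverse (q1 - q4) * (q2 - q4) * inverse (q2 - q3)"

definition is_diameter :: "quat set \<Rightarrow> bool" where
  "is_diameter L \<longleftrightarrow> (\<exists>u. norm u = 1 \<and> L = closed_segment (- u) u)"

text \<open>The circle with centre \<open>c\<close> and radius \<open>r\<close> in the affine plane \<open>c + P\<close>. At a point \<open>x\<close> its
  tangent line consists of the \<open>v \<in> P\<close> orthogonal to \<open>x - c\<close>, while the tangent space of the unit
  sphere consists of the \<open>w\<close> orthogonal to \<open>x\<close>. The circle has to meet the sphere: otherwise the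
  orthogonality condition would be vacuous.\<close>

definition is_orthogonal_circle :: "quat set \<Rightarrow> bool" where
  "is_orthogonal_circle C \<longleftrightarrow>
    (\<exists>c r P. 0 < r \<and> subspace P \<and> dim P = 2 \<and> C = {x. x - c \<in> P \<and> norm (x - c) = r} \<and>
       C \<inter> sphere 0 1 \<noteq> {} \<and>
       (\<forall>x \<in> C \<inter> sphere 0 1. \<forall>v \<in> P. \<forall>w.
          orthogonal v (x - c) \<longrightarrow> orthogonal w x \<longrightarrow> orthogonal v w))"

definition noneuclidean_line :: "quat \<Rightarrow> quat \<Rightarrow> quat set" where
  "noneuclidean_line q1 q2 =
    (THE L. q1 \<in> L \<and> q2 \<in> L \<and>
       (if dependent {q1, q2} then is_diameter L else is_orthogonal_circle L))"

text \<open>Four distinct points of a circle are in cyclic order \<open>a, b, c, d\<close> (for one of the two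
  orientations) iff \<open>a, c\<close> separate \<open>b\<close> from \<open>d\<close> on it. The same condition covers a diameter, on
  which cyclic order means linear order up to rotation, as in \<open>d, a, b, c\<close>.\<close>

definition cyclically_arranged_on :: "quat set \<Rightarrow> quat \<Rightarrow> quat \<Rightarrow> quat \<Rightarrow> quat \<Rightarrow> bool" where
  "cyclically_arranged_on L a b c d \<longleftrightarrow>
    {a, b, c, d} \<subseteq> L \<and> distinct [a, b, c, d] \<and> \<not> connected_component (L - {a, c}) b d"

definition line_ends :: "quat \<Rightarrow> quat \<Rightarrow> quat \<times> quat" where
  "line_ends q1 q2 =
    (THE (q3, q4). noneuclidean_line q1 q2 \<inter> sphere 0 1 = {q3, q4} \<and>
       cyclically_arranged_on (noneuclidean_line q1 q2) q1 q2 q3 q4)"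

text \<open>The cross-ratio of four points on a circle or a line is a real quaternion, which is read
  as a real number through its real part.\<close>

definition quat_poincare_dist :: "quat \<Rightarrow> quat \<Rightarrow> real" where
  "quat_poincare_dist q1 q2 =
    (if q1 = q2 then 0
     else let (q3, q4) = line_ends q1 q2 in 1 / 2 * ln (Re (cpart (cross_ratio q1 q2 q3 q4))))"


section \<open>The Kobayashi distance\<close>

text \<open>The Moebius-invariant extension of \<open>(0, z) \<mapsto> 1/2 log ((1 + \<bar>z\<bar>) / (1 - \<bar>z\<bar>))\<close>.\<close>

definition disc_poincare_dist :: "complex \<Rightarrow> complex \<Rightarrow> real" where
  "disc_poincare_dist z w =
    (let m = cmod ((z - w) / (1 - cnj w * z)) in 1 / 2 * ln ((1 + m) / (1 - m)))"

definition holomorphic_disc :: "(complex ^ 'n) set \<Rightarrow> (complex \<Rightarrow> complex ^ 'n) \<Rightarrow> bool" where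
  "holomorphic_disc X f \<longleftrightarrow>
    (\<forall>k. (\<lambda>z. f z $ k) holomorphic_on ball 0 1) \<and> f ` ball 0 1 \<subseteq> X"

text \<open>The infimum runs over all chains \<open>x = p 0, \<dots>, p n = y\<close> in which \<open>p i\<close> and \<open>p (Suc i)\<close> are
  the images of \<open>a i\<close> and \<open>b i\<close> under a holomorphic disc \<open>f i\<close>.\<close>

definition kobayashi_dist :: "(complex ^ 'n) set \<Rightarrow> complex ^ 'n \<Rightarrow> complex ^ 'n \<Rightarrow> real" where
  "kobayashi_dist X x y =
    Inf {(\<Sum>i<n. disc_poincare_dist (a i) (b i)) | (n :: nat) p f a b.
      0 < n \<and> p 0 = x \<and> p n = y \<and>
      (\<forall>i<n. holomorphic_disc X (f i) \<and> a i \<in> ball 0 1 \<and> b i \<in> ball 0 1 \<and>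
              f i (a i) = p i \<and> f i (b i) = p (Suc i))}"


section \<open>Isometric metric spaces\<close>

definition isometric_spaces ::
    "'a set \<Rightarrow> ('a \<Rightarrow> 'a \<Rightarrow> real) \<Rightarrow> 'b set \<Rightarrow> ('b \<Rightarrow> 'b \<Rightarrow> real) \<Rightarrow> bool" where
  "isometric_spaces M d N e \<longleftrightarrow>
    (\<exists>f. bij_betw f M N \<and> (\<forall>x\<in>M. \<forall>y\<in>M. e (f x) (f y) = d x y))"

end

theory Submission
  imports Defs
begin

text \<open>
  The quaternionic ball with the Poincare distance is the conformal ball model of real hyperbolic
  \<open>4\<close>-space of constant curvature \<open>-4\<close>, while the complex ball with the Kobayashi distance is the complex
  hyperbolic plane, whose curvature is \<open>-4\<close> on complex lines but \<open>-1\<close> on totally real planes. An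
  isosceles right triangle tells them apart.

  The complex ball is homogeneous: the involutions \<open>ball_involution\<close> exchange a given point with the
  origin and preserve the Kobayashi distance, which by the Schwarz-Pick lemma is \<open>artanh \<bar>z\<bar>\<close> from the
  origin to \<open>z\<close> (\<open>kobayashi_ball_0\<close>). This gives the distance of any two points
  (\<open>kobayashi_dist_ball\<close>), and it lets a hypothetical isometry be replaced by one that matches the two
  origins. The quaternionic distance then enters only from the origin and between points of equal norm,
  where the non-Euclidean line is a diameter or a circle that is symmetric about the sum of the two
  points (\<open>quat_poincare_dist_0\<close>, \<open>quat_poincare_dist_equal_norms\<close>).

  An isometry \<open>F\<close> from the complex to the quaternionic ball with \<open>F 0 = 0\<close> then preserves norms, and on
  the sphere of radius \<open>t\<close> it satisfies
  \<open>\<bar>F z - F z'\<bar>\<^sup>2 = \<bar>1 - \<langle>z', z\<rangle>\<bar>\<^sup>2 - (1 - t\<^sup>2)\<^sup>2\<close> (\<open>dist_of_centred_isometry\<close>).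
  For \<open>z' = - z\<close> the right-hand side is \<open>4 t\<^sup>2\<close>, so \<open>F\<close> maps antipodal points to antipodal points. For a vector \<open>Q\<close>
  with \<open>\<langle>Q, P\<rangle> = 0\<close> it is \<open>2 t\<^sup>2 - t\<^sup>4\<close>, for \<open>P\<close> as well as for \<open>- P\<close>; but the squared chords from a point
  of a Euclidean sphere to two antipodal points add up to \<open>4 t\<^sup>2\<close>. The defect \<open>t\<^sup>4\<close> reflects the different
  curvature of the totally real plane through \<open>P\<close> and \<open>Q\<close>.
\<close>

section \<open>The inverse hyperbolic tangent\<close>

lemma artanh_real_less_iff:
  fixes x y :: real
  assumes "\<bar>x\<bar> < 1" "\<bar>y\<bar> < 1"
  shows "artanh x < artanh y \<longleftrightarrow> x < y"
proof -
  have "artanh x < artanh y \<longleftrightarrow> (1 + x) / (1 - x) < (1 + y) / (1 - y)"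
    using assms by (simp add: artanh_def)
  also have "\<dots> \<longleftrightarrow> x < y"
    using assms by (simp add: field_simps abs_less_iff)
  finally show ?thesis .
qed

lemma artanh_real_le_iff:
  fixes x y :: real
  assumes "\<bar>x\<bar> < 1" "\<bar>y\<bar> < 1"
  shows "artanh x \<le> artanh y \<longleftrightarrow> x \<le> y"
  using artanh_real_less_iff[OF assms(2,1)] by linarith

lemma artanh_real_eq_iff:
  fixes x y :: real
  assumes "\<bar>x\<bar> < 1" "\<bar>y\<bar> < 1"
  shows "artanh x = artanh y \<longleftrightarrow> x = y"
  using artanh_real_less_iff[OF assms] artanh_real_less_iff[OF assms(2,1)] by force

lemma artanh_real_add:
  fixes x y :: real
  assumes "0 \<le> x" "x < 1" "0 \<le> y" "y < 1"
  shows "artanh x + artanh y = artanh ((x + y) / (1 + x * y))"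
proof -
  have p: "1 + x * y > 0"
    using assms by (simp add: add_pos_nonneg)
  have e: "(1 + (x + y) / (1 + x * y)) / (1 - (x + y) / (1 + x * y)) = ((1 + x) * (1 + y)) / ((1 - x) * (1 - y))"
  proof -
    have "1 + (x + y) / (1 + x * y) = ((1 + x) * (1 + y)) / (1 + x * y)"
      "1 - (x + y) / (1 + x * y) = ((1 - x) * (1 - y)) / (1 + x * y)"
      using p by (simp_all add: field_simps)
    then show ?thesis using p by simp
  qed
  have "ln ((1 + x) * (1 + y) / ((1 - x) * (1 - y))) = ln ((1 + x) / (1 - x)) + ln ((1 + y) / (1 - y))"
    using assms by (simp add: ln_mult ln_div)
  then show ?thesis
    unfolding artanh_def e by simp
qed

section \<open>The Poincare distance of the unit disc\<close>

lemma disc_poincare_dist_artanh: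
  "disc_poincare_dist z w = artanh (cmod (Moebius_function 0 w z))"
  by (simp add: disc_poincare_dist_def artanh_def Moebius_function_simple Let_def)

lemma disc_poincare_dist_nonneg:
  assumes "z \<in> ball 0 1" "w \<in> ball 0 1"
  shows "0 \<le> disc_poincare_dist z w"
  using artanh_real_le_iff[of 0 "cmod (Moebius_function 0 w z)"] Moebius_function_norm_lt_1[of w z 0] assms
  by (simp add: disc_poincare_dist_artanh)

text \<open>Moving \<open>b\<close> and \<open>g b\<close> to the origin by disc automorphisms reduces this to the Schwarz lemma.\<close>

lemma Schwarz_Pick:
  assumes g: "g holomorphic_on ball 0 1" "g ` ball 0 1 \<subseteq> ball 0 1"
    and ab: "a \<in> ball 0 1" "b \<in> ball 0 1"
  shows "disc_poincare_dist (g a) (g b) \<le> disc_poincare_dist a b"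
proof -
  have gb: "cmod (g z) < 1" if "cmod z < 1" for z
    using g(2) that by force
  have a: "cmod a < 1" and b: "cmod b < 1" using ab by auto
  define F where "F = Moebius_function 0 (g b) \<circ> (g \<circ> Moebius_function 0 (- b))"
  have "F holomorphic_on ball 0 1"
    unfolding F_def
    by (intro holomorphic_on_compose_gen[where t = "ball 0 1"] Moebius_function_holomorphic g)
       (auto intro!: Moebius_function_norm_lt_1 gb b)
  moreover have "F 0 = 0"
    by (simp add: F_def Moebius_function_of_zero Moebius_function_eq_zero)
  moreover have "cmod (F z) < 1" if "cmod z < 1" for z
    using that b by (auto simp: F_def intro!: Moebius_function_norm_lt_1 gb)
  moreover have m: "cmod (Moebius_function 0 b a) < 1"
    using a b by (rule Moebius_function_norm_lt_1[rotated])
  ultimately have "cmod (F (Moebius_function 0 b a)) \<le> cmod (Moebius_function 0 b a)"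
    by (rule Schwarz_Lemma(1))
  moreover have "F (Moebius_function 0 b a) = Moebius_function 0 (g b) (g a)"
    using Moebius_function_compose[of "- b" b a] a b by (simp add: F_def)
  ultimately show ?thesis
    using m Moebius_function_norm_lt_1[OF gb gb, OF b a, of 0]
    by (simp add: disc_poincare_dist_artanh artanh_real_le_iff)
qed

text \<open>The case of the triangle inequality in which one of the three points is the origin, which
  serves to add up a chain that starts at the origin. With \<open>m\<close> the pseudo-hyperbolic
  distance of \<open>z\<close> and \<open>w\<close>, the identity
  \<open>1 - m\<^sup>2 = (1 - \<bar>z\<bar>\<^sup>2) (1 - \<bar>w\<bar>\<^sup>2) / \<bar>1 - cnj w z\<bar>\<^sup>2\<close> shows that \<open>m\<close> does not increase when \<open>z\<close> and \<open>w\<close> are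
  rotated onto the same radius, and there the inequality is the addition formula of \<open>artanh\<close>.\<close>

lemma artanh_norm_le_disc_poincare_dist:
  assumes "z \<in> ball 0 1" "w \<in> ball 0 1"
  shows "artanh (cmod w) \<le> artanh (cmod z) + disc_poincare_dist z w"
proof -
  define m where "m = cmod (Moebius_function 0 w z)"
  have z: "cmod z < 1" and w: "cmod w < 1" using assms by auto
  have m: "0 \<le> m" "m < 1"
    using Moebius_function_norm_lt_1[OF w z] by (auto simp: m_def)
  define N where "N = cmod (1 - cnj w * z)"
  have wz: "cmod w * cmod z < 1"
    using mult_strict_mono[OF w z] by simp
  have N: "1 - cmod w * cmod z \<le> N"
    using norm_triangle_ineq2[of 1 "cnj w * z"] by (simp add: N_def norm_mult)
  have Npos: "0 < N" using N wz by linarith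
  have zw: "cmod (z - w) = m * N"
    using Npos by (auto simp: m_def Moebius_function_simple norm_divide N_def)
  have id: "(cmod (z - w))\<^sup>2 = N\<^sup>2 - (1 - (cmod z)\<^sup>2) * (1 - (cmod w)\<^sup>2)"
    unfolding N_def cmod_power2 by (simp add: power2_eq_square algebra_simps)
  have "cmod w - cmod z \<le> m * (1 - cmod w * cmod z)"
  proof (rule ccontr)
    assume "\<not> ?thesis"
    then have less: "m * (1 - cmod w * cmod z) < cmod w - cmod z" by simp
    have nn: "0 \<le> m * (1 - cmod w * cmod z)"
      using m wz by simp
    have "(m * (1 - cmod w * cmod z))\<^sup>2 < (cmod w - cmod z)\<^sup>2"
      using less nn by (intro power_strict_mono) auto
    also have "(cmod w - cmod z)\<^sup>2 = (1 - cmod w * cmod z)\<^sup>2 - (1 - (cmod z)\<^sup>2) * (1 - (cmod w)\<^sup>2)"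
      by (simp add: power2_eq_square algebra_simps)
    finally have "(1 - (cmod z)\<^sup>2) * (1 - (cmod w)\<^sup>2) < (1 - m\<^sup>2) * (1 - cmod w * cmod z)\<^sup>2"
      unfolding power_mult_distrib left_diff_distrib[of 1 "m\<^sup>2" "(1 - cmod w * cmod z)\<^sup>2"] by linarith
    also have "\<dots> \<le> (1 - m\<^sup>2) * N\<^sup>2"
      using N wz m by (intro mult_left_mono power_mono) (auto simp: power_le_one)
    also have "\<dots> = (1 - (cmod z)\<^sup>2) * (1 - (cmod w)\<^sup>2)"
      using id zw by (simp add: power_mult_distrib algebra_simps)
    finally show False by simp
  qed
  then have le: "cmod w \<le> (cmod z + m) / (1 + cmod z * m)"
    using m by (simp add: pos_le_divide_eq add_pos_nonneg algebra_simps)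
  have lt: "(cmod z + m) / (1 + cmod z * m) < 1"
  proof -
    have "0 < (1 - cmod z) * (1 - m)" using z m by simp
    then show ?thesis
      using m by (subst pos_divide_less_eq) (auto simp: add_pos_nonneg algebra_simps)
  qed
  have "artanh (cmod w) \<le> artanh ((cmod z + m) / (1 + cmod z * m))"
    using le lt w m by (subst artanh_real_le_iff) (auto simp: abs_less_iff intro: order_less_le_trans[of _ 0])
  also have "\<dots> = artanh (cmod z) + artanh m"
    using artanh_real_add[of "cmod z" m] z m by simp
  finally show ?thesis by (simp add: disc_poincare_dist_artanh m_def)
qed

section \<open>The Hermitian product\<close>

definition hermitian_product :: "complex ^ 'n \<Rightarrow> complex ^ 'n \<Rightarrow> complex" where
  "hermitian_product z w = (\<Sum>k\<in>UNIV. z $ k * cnj (w $ k))"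

lemma hermitian_product_linear [simp]:
  "hermitian_product (x - y) w = hermitian_product x w - hermitian_product y w"
  "hermitian_product w (x - y) = hermitian_product w x - hermitian_product w y"
  "hermitian_product (c *s x) w = c * hermitian_product x w"
  "hermitian_product w (c *s x) = cnj c * hermitian_product w x"
  "hermitian_product 0 w = 0" "hermitian_product w 0 = 0"
  "hermitian_product (- x) w = - hermitian_product x w"
  "hermitian_product w (- x) = - hermitian_product w x"
  by (simp_all add: hermitian_product_def sum_subtractf sum_distrib_left sum_negf algebra_simps)

lemma cnj_hermitian_product: "cnj (hermitian_product z w) = hermitian_product w z"
  by (simp add: hermitian_product_def mult.commute)

lemma hermitian_product_self: "hermitian_product z z = of_real ((norm z)\<^sup>2)"
  by (simp add: hermitian_product_def norm_vec_def L2_set_def sum_nonneg complex_norm_square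
      del: of_real_power)

lemma norm_hermitian_product_le: "cmod (hermitian_product z w) \<le> norm z * norm w"
proof -
  have "cmod (hermitian_product z w) \<le> (\<Sum>k\<in>UNIV. \<bar>norm (z $ k)\<bar> * \<bar>norm (w $ k)\<bar>)"
    unfolding hermitian_product_def by (rule sum_norm_le) (simp add: norm_mult)
  also have "\<dots> \<le> norm z * norm w"
    unfolding norm_vec_def by (rule L2_set_mult_ineq)
  finally show ?thesis .
qed

lemma hermitian_product_ball:
  assumes "z \<in> ball 0 1" "w \<in> cball 0 1"
  shows "hermitian_product z w \<in> ball 0 1"
proof -
  have "cmod (hermitian_product z w) \<le> norm z * 1"
    using norm_hermitian_product_le[of z w] assms mult_left_mono[of "norm w" 1 "norm z"] by auto
  then show ?thesis using assms by auto
qed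

section \<open>Chains of holomorphic discs\<close>

text \<open>The Kobayashi distance is built from holomorphic discs alone, so it cannot increase under any map
  that sends discs to discs. Asking for this property instead of holomorphy in several variables
  leaves only functions of one complex variable to be dealt with.\<close>

definition preserves_holomorphic_discs :: "(complex ^ 'n) set \<Rightarrow> (complex ^ 'n \<Rightarrow> complex ^ 'm) \<Rightarrow> (complex ^ 'm) set \<Rightarrow> bool" where
  "preserves_holomorphic_discs X h Y \<longleftrightarrow> (\<forall>f. holomorphic_disc X f \<longrightarrow> holomorphic_disc Y (h \<circ> f))"

definition chain_lengths :: "(complex ^ 'n) set \<Rightarrow> complex ^ 'n \<Rightarrow> complex ^ 'n \<Rightarrow> real set" where
  "chain_lengths X x y = {(\<Sum>i<n. disc_poincare_dist (a i) (b i)) | (n :: nat) p f a b.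
      0 < n \<and> p 0 = x \<and> p n = y \<and>
      (\<forall>i<n. holomorphic_disc X (f i) \<and> a i \<in> ball 0 1 \<and> b i \<in> ball 0 1 \<and>
              f i (a i) = p i \<and> f i (b i) = p (Suc i))}"

lemma kobayashi_dist_chain_lengths: "kobayashi_dist X x y = Inf (chain_lengths X x y)"
  by (simp add: kobayashi_dist_def chain_lengths_def)

lemma chain_lengthsE:
  assumes "l \<in> chain_lengths X x y"
  obtains n :: nat and p f a b where "l = (\<Sum>i<n. disc_poincare_dist (a i) (b i))"
    "p 0 = x" "p n = y"
    "\<And>i. i < n \<Longrightarrow> holomorphic_disc X (f i)"
    "\<And>i. i < n \<Longrightarrow> a i \<in> ball 0 1" "\<And>i. i < n \<Longrightarrow> b i \<in> ball 0 1"
    "\<And>i. i < n \<Longrightarrow> f i (a i) = p i" "\<And>i. i < n \<Longrightarrow> f i (b i) = p (Suc i)"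
  using assms unfolding chain_lengths_def mem_Collect_eq by (elim exE conjE) blast

lemma chain_lengths_nonneg: "l \<in> chain_lengths X x y \<Longrightarrow> 0 \<le> l"
  unfolding chain_lengths_def by (force intro!: sum_nonneg disc_poincare_dist_nonneg)

lemma chain_lengths_preserves:
  assumes "preserves_holomorphic_discs X h Y"
  shows "chain_lengths X x y \<subseteq> chain_lengths Y (h x) (h y)"
proof
  fix l assume "l \<in> chain_lengths X x y"
  then obtain n :: nat and p f a b where c: "l = (\<Sum>i<n. disc_poincare_dist (a i) (b i))"
    "0 < n" "p 0 = x" "p n = y"
      "\<forall>i<n. holomorphic_disc X (f i) \<and> a i \<in> ball 0 1 \<and> b i \<in> ball 0 1 \<and>
              f i (a i) = p i \<and> f i (b i) = p (Suc i)"
    unfolding chain_lengths_def by blast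
  show "l \<in> chain_lengths Y (h x) (h y)"
    unfolding chain_lengths_def
    using c assms unfolding preserves_holomorphic_discs_def
    by (intro CollectI exI[of _ n] exI[of _ "h \<circ> p"] exI[of _ "\<lambda>i. h \<circ> f i"] exI[of _ a] exI[of _ b]) simp
qed

lemma single_disc_in_chain_lengths:
  assumes "holomorphic_disc X f" "a \<in> ball 0 1" "b \<in> ball 0 1"
  shows "disc_poincare_dist a b \<in> chain_lengths X (f a) (f b)"
proof -
  have "disc_poincare_dist a b = (\<Sum>i<Suc 0. disc_poincare_dist a b)" by simp
  moreover have "f a = (\<lambda>i::nat. if i = 0 then f a else f b) 0" by simp
  ultimately show ?thesis
    unfolding chain_lengths_def using assms
    by (intro CollectI exI[of _ "Suc 0"] exI[of _ "\<lambda>i::nat. if i = 0 then f a else f b"] exI[of _ "\<lambda>_. f"]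
        exI[of _ "\<lambda>_. a"] exI[of _ "\<lambda>_. b"]) simp
qed

lemma kobayashi_dist_le:
  assumes "preserves_holomorphic_discs X h Y" "chain_lengths X x y \<noteq> {}"
  shows "kobayashi_dist Y (h x) (h y) \<le> kobayashi_dist X x y"
  unfolding kobayashi_dist_chain_lengths
  by (rule cInf_superset_mono[OF assms(2) _ chain_lengths_preserves[OF assms(1)]])
     (auto intro!: bdd_belowI[of _ 0] chain_lengths_nonneg)

section \<open>The Kobayashi distance of the ball from the origin\<close>

definition radial_disc :: "complex ^ 'n \<Rightarrow> complex \<Rightarrow> complex ^ 'n" where
  "radial_disc z \<zeta> = (\<zeta> / of_real (norm z)) *s z"

lemma norm_vector_scalar_mult: "norm (c *s z) = cmod c * norm z" for z :: "complex ^ 'n"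
proof -
  have "complex_of_real ((norm (c *s z))\<^sup>2) = of_real ((cmod c * norm z)\<^sup>2)"
    unfolding hermitian_product_self[symmetric] power_mult_distrib of_real_mult hermitian_product_linear
      complex_norm_square by (simp add: algebra_simps)
  then have "(norm (c *s z))\<^sup>2 = (cmod c * norm z)\<^sup>2"
    using of_real_eq_iff by blast
  then show ?thesis by (simp add: power2_eq_iff_nonneg)
qed

lemma holomorphic_radial_disc: "holomorphic_disc (ball 0 1) (radial_disc z)"
proof -
  have "norm (radial_disc z \<zeta>) < 1" if "cmod \<zeta> < 1" for \<zeta>
    using that by (cases "z = 0") (auto simp: radial_disc_def norm_vector_scalar_mult norm_divide)
  then show ?thesis
    by (cases "z = 0") (auto simp: holomorphic_disc_def radial_disc_def intro!: holomorphic_intros)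
qed

text \<open>The radial disc joins the origin to \<open>z\<close> and gives the upper bound. For the lower bound, the
  functional \<open>p \<mapsto> \<langle>p, z / \<bar>z\<bar>\<rangle>\<close> maps the ball holomorphically into the unit disc; by the Schwarz-Pick
  lemma every chain projects to a chain in the disc that is not longer and leads from \<open>0\<close> to \<open>\<bar>z\<bar>\<close>.\<close>

lemma kobayashi_ball_0:
  assumes "z \<in> ball 0 1"
  shows "artanh (norm z) \<in> chain_lengths (ball 0 1) 0 z"
    and "kobayashi_dist (ball 0 1) 0 z = artanh (norm z)"
proof -
  have z: "norm z < 1" using assms by simp
  have "disc_poincare_dist 0 (of_real (norm z)) \<in> chain_lengths (ball 0 1) (radial_disc z 0) (radial_disc z (of_real (norm z)))"
    using z by (intro single_disc_in_chain_lengths holomorphic_radial_disc) auto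
  then show mem: "artanh (norm z) \<in> chain_lengths (ball 0 1) 0 z"
    by (cases "z = 0") (auto simp: radial_disc_def disc_poincare_dist_artanh Moebius_function_of_zero)
  have lower: "artanh (norm z) \<le> l" if l: "l \<in> chain_lengths (ball 0 1) 0 z" for l
  proof -
    obtain n :: nat and p f a b where c: "l = (\<Sum>i<n. disc_poincare_dist (a i) (b i))"
      "p 0 = 0" "p n = z"
      and s: "\<And>i. i < n \<Longrightarrow> holomorphic_disc (ball 0 1) (f i)"
        "\<And>i. i < n \<Longrightarrow> a i \<in> ball 0 1" "\<And>i. i < n \<Longrightarrow> b i \<in> ball 0 1"
        "\<And>i. i < n \<Longrightarrow> f i (a i) = p i" "\<And>i. i < n \<Longrightarrow> f i (b i) = p (Suc i)"
      using l by (rule chain_lengthsE) blast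
    \<comment> \<open>For \<open>z = 0\<close> this is \<open>e = 0\<close>, which is why only \<open>norm e \<le> 1\<close> is used below.\<close>
    define e where "e = inverse (complex_of_real (norm z)) *s z"
    have e: "e \<in> cball 0 1"
      by (cases "z = 0") (simp_all add: e_def norm_vector_scalar_mult norm_inverse)
    have "artanh (cmod (hermitian_product (p k) e)) \<le> (\<Sum>i<k. disc_poincare_dist (a i) (b i))" if "k \<le> n" for k
      using that
    proof (induction k)
      case 0
      then show ?case using c by simp
    next
      case (Suc k)
      define g where "g = (\<lambda>\<zeta>. hermitian_product (f k \<zeta>) e)"
      have sk: "holomorphic_disc (ball 0 1) (f k)" "a k \<in> ball 0 1" "b k \<in> ball 0 1"
              "f k (a k) = p k" "f k (b k) = p (Suc k)"
        using s Suc.prems by simp_all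
      have hol: "g holomorphic_on ball 0 1"
        using sk(1) unfolding g_def hermitian_product_def holomorphic_disc_def
        by (intro holomorphic_intros) auto
      have im: "g \<zeta> \<in> ball 0 1" if "\<zeta> \<in> ball 0 1" for \<zeta>
        unfolding g_def using sk(1) e that
        by (intro hermitian_product_ball) (auto simp: holomorphic_disc_def image_subset_iff)
      have "artanh (cmod (g (b k))) \<le> artanh (cmod (g (a k))) + disc_poincare_dist (g (a k)) (g (b k))"
        by (intro artanh_norm_le_disc_poincare_dist im sk)
      also have "\<dots> \<le> artanh (cmod (g (a k))) + disc_poincare_dist (a k) (b k)"
        using im by (intro add_left_mono Schwarz_Pick hol sk) auto
      finally show ?case
        using Suc sk by (simp add: g_def)
    qed
    from this[of n] have "artanh (cmod (hermitian_product z e)) \<le> l"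
      using c by simp
    moreover have "cmod (hermitian_product z e) = norm z"
      by (cases "z = 0") (simp_all add: e_def hermitian_product_self norm_mult power2_eq_square norm_inverse)
    ultimately show ?thesis by simp
  qed
  show "kobayashi_dist (ball 0 1) 0 z = artanh (norm z)"
    unfolding kobayashi_dist_chain_lengths
    by (rule cInf_eq_minimum[OF mem lower])
qed

section \<open>Automorphisms of the ball and the Kobayashi distance\<close>

text \<open>The automorphism of the ball that exchanges \<open>a\<close> and the origin. With \<open>P\<close> the orthogonal projection
  onto the complex line through \<open>a\<close> and \<open>s = sqrt (1 - \<bar>a\<bar>\<^sup>2)\<close>, it is usually written
  \<open>z \<mapsto> (a - P z - s (z - P z)) / (1 - \<langle>z, a\<rangle>)\<close>. Since \<open>\<bar>a\<bar>\<^sup>2 = (1 - s) (1 + s)\<close>, the numerator equals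
  \<open>(1 - \<langle>z, a\<rangle> / (1 + s)) a - s z\<close>, which needs no case distinction for \<open>a = 0\<close>.\<close>

definition ball_involution :: "complex ^ 'n \<Rightarrow> complex ^ 'n \<Rightarrow> complex ^ 'n" where
  "ball_involution a z =
    (let s = of_real (sqrt (1 - (norm a)\<^sup>2)); h = hermitian_product z a
     in inverse (1 - h) *s ((1 - h / (1 + s)) *s a - s *s z))"

context
  fixes a :: "complex ^ 'n"
  assumes a: "a \<in> ball 0 1"
begin

lemma one_minus_hermitian_product_nonzero: "z \<in> ball 0 1 \<Longrightarrow> 1 - hermitian_product z a \<noteq> 0"
  using hermitian_product_ball[of z a] a by (auto simp: less_imp_le)

lemma norm_ball_involution:
  assumes z: "z \<in> ball 0 1"
  shows "1 - (norm (ball_involution a z))\<^sup>2 =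
    (1 - (norm a)\<^sup>2) * (1 - (norm z)\<^sup>2) / (cmod (1 - hermitian_product z a))\<^sup>2"
proof -
  define s where "s = sqrt (1 - (norm a)\<^sup>2)"
  define h where "h = hermitian_product z a"
  define w where "w = (1 - h / (1 + of_real s)) *s a - of_real s *s z"
  have s0: "0 \<le> s" and s2: "(norm a)\<^sup>2 = 1 - s\<^sup>2"
    using a by (auto simp: s_def power_le_one less_imp_le)
  have s1: "1 + complex_of_real s \<noteq> 0"
    using s0 by (metis add_nonneg_eq_0_iff of_real_1 of_real_add of_real_eq_0_iff zero_neq_one zero_le_one)
  have h1: "1 - h \<noteq> 0" unfolding h_def by (rule one_minus_hermitian_product_nonzero[OF z])
  \<comment> \<open>In terms of \<open>q\<close> both sides become polynomials.\<close>
  define q where "q = h / (1 + of_real s)"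
  have hq: "h = q * (1 + of_real s)" using s1 by (simp add: q_def)
  have "of_real ((norm w)\<^sup>2) = hermitian_product w w" by (simp only: hermitian_product_self)
  also have "\<dots> = (1 - q) * (1 - cnj q) * (1 - of_real s ^ 2) - of_real s * (1 - q) * cnj h
      - of_real s * (1 - cnj q) * h + of_real s ^ 2 * of_real ((norm z)\<^sup>2)"
  proof -
    have aa: "hermitian_product a a = 1 - of_real s ^ 2"
      unfolding hermitian_product_self s2 by simp
    have zz: "hermitian_product z z = of_real ((norm z)\<^sup>2)" by (rule hermitian_product_self)
    have az: "hermitian_product a z = cnj h" "hermitian_product z a = h"
      by (simp_all add: h_def cnj_hermitian_product)
    have w: "w = (1 - q) *s a - of_real s *s z" by (simp add: w_def q_def)
    show ?thesis
      unfolding w hermitian_product_linear aa zz az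
      by (simp add: algebra_simps power2_eq_square)
  qed
  also have "\<dots> = (1 - h) * cnj (1 - h) - of_real s ^ 2 * (1 - of_real ((norm z)\<^sup>2))"
    by (simp add: hq algebra_simps power2_eq_square)
  also have "\<dots> = of_real ((cmod (1 - h))\<^sup>2 - s\<^sup>2 * (1 - (norm z)\<^sup>2))"
    by (simp only: complex_norm_square[symmetric] of_real_diff of_real_mult of_real_power of_real_1)
  finally have nw: "(norm w)\<^sup>2 = (cmod (1 - h))\<^sup>2 - s\<^sup>2 * (1 - (norm z)\<^sup>2)"
    using of_real_eq_iff by blast
  have "ball_involution a z = inverse (1 - h) *s w"
    by (simp add: ball_involution_def Let_def w_def h_def s_def)
  then have "(norm (ball_involution a z))\<^sup>2 = (norm w)\<^sup>2 / (cmod (1 - h))\<^sup>2"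
    by (simp only: norm_vector_scalar_mult norm_inverse power_mult_distrib divide_inverse power_inverse mult.commute)
  then show ?thesis
    using h1 by (simp add: nw s2 h_def[symmetric] field_simps)
qed

lemma ball_involution_in_ball:
  assumes z: "z \<in> ball 0 1"
  shows "ball_involution a z \<in> ball 0 1"
proof -
  have "0 < (1 - (norm a)\<^sup>2) * (1 - (norm z)\<^sup>2) / (cmod (1 - hermitian_product z a))\<^sup>2"
    using a z one_minus_hermitian_product_nonzero[OF z] by (simp add: abs_square_less_1)
  then show ?thesis
    unfolding norm_ball_involution[OF z, symmetric] by (simp add: abs_square_less_1)
qed

lemma ball_involution_involution:
  assumes z: "z \<in> ball 0 1"
  shows "ball_involution a (ball_involution a z) = z"
proof -
  define s where "s = complex_of_real (sqrt (1 - (norm a)\<^sup>2))"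
  define h where "h = hermitian_product z a"
  define k where "k = hermitian_product (ball_involution a z) a"
  have na: "0 < 1 - (norm a)\<^sup>2" using a by (simp add: abs_square_less_1)
  have s0: "s \<noteq> 0" using na by (simp add: s_def)
  have s1: "1 + s \<noteq> 0"
    using na unfolding s_def
    by (metis add_nonneg_eq_0_iff of_real_1 of_real_add of_real_eq_0_iff zero_neq_one zero_le_one real_sqrt_ge_zero less_imp_le)
  have "s\<^sup>2 = 1 - of_real ((norm a)\<^sup>2)"
    using na by (simp add: s_def flip: of_real_power)
  then have a2: "hermitian_product a a = 1 - s\<^sup>2" by (simp add: hermitian_product_self)
  have h1: "1 - h \<noteq> 0" unfolding h_def by (rule one_minus_hermitian_product_nonzero[OF z])
  \<comment> \<open>With \<open>h = q (1 + s)\<close> the coefficient of \<open>a\<close> cancels by polynomial identities.\<close>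
  define q where "q = h / (1 + s)"
  have hq: "h = q * (1 + s)" using s1 by (simp add: q_def)
  have inv: "ball_involution a z = inverse (1 - h) *s ((1 - q) *s a - s *s z)"
    by (simp add: ball_involution_def Let_def s_def h_def q_def)
  have k: "k = inverse (1 - h) * ((1 - q) * (1 - s\<^sup>2) - s * h)"
    unfolding k_def inv hermitian_product_linear a2 h_def ..
  have "1 - k = inverse (1 - h) * ((1 - h) - ((1 - q) * (1 - s\<^sup>2) - s * h))"
    using h1 by (simp add: k field_simps)
  also have "\<dots> = inverse (1 - h) * s\<^sup>2"
    by (simp add: hq algebra_simps power2_eq_square)
  finally have k1: "1 - k = s\<^sup>2 / (1 - h)" by (simp add: field_simps)
  have "k / (1 + s) = (1 - s - q) / (1 - h)"
  proof -
    have "(1 - q) * (1 - s\<^sup>2) - s * h = (1 - s - q) * (1 + s)"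
      by (simp add: hq algebra_simps power2_eq_square)
    then show ?thesis unfolding k using s1 h1 by (simp add: divide_simps)
  qed
  then have c: "1 - k / (1 + s) = s * (1 - q) / (1 - h)"
    using h1 by (simp add: hq field_simps)
  have "ball_involution a (ball_involution a z) =
      inverse (1 - k) *s ((1 - k / (1 + s)) *s a - s *s ball_involution a z)"
    unfolding ball_involution_def[of a "ball_involution a z"] Let_def s_def k_def ..
  also have "(1 - k / (1 + s)) *s a - s *s ball_involution a z = (s\<^sup>2 / (1 - h)) *s z"
    unfolding inv c by (simp add: vec_eq_iff divide_inverse algebra_simps power2_eq_square)
  also have "inverse (1 - k) *s ((s\<^sup>2 / (1 - h)) *s z) = z"
    using s0 h1 by (simp add: k1 vector_smult_assoc)
  finally show ?thesis .
qed

lemma ball_involution_self: "ball_involution a a = 0"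
proof -
  have t: "1 - hermitian_product a a = of_real (1 - (norm a)\<^sup>2)"
    by (simp add: hermitian_product_self)
  have "1 - (norm (ball_involution a a))\<^sup>2 = 1"
    unfolding norm_ball_involution[OF a] t norm_of_real
    using a by (simp add: abs_square_less_1 less_imp_neq power2_eq_square[of "1 - (norm a)\<^sup>2"])
  then show ?thesis by simp
qed

lemma ball_involution_0: "ball_involution a 0 = a"
  by (simp add: ball_involution_def)

lemma ball_involution_preserves_holomorphic_discs:
  "preserves_holomorphic_discs (ball 0 1) (ball_involution a) (ball 0 1)"
proof -
  have "(\<lambda>\<zeta>. ball_involution a (f \<zeta>) $ k) holomorphic_on ball 0 1"
    if f: "\<And>k. (\<lambda>\<zeta>. f \<zeta> $ k) holomorphic_on ball 0 1" and im: "\<And>\<zeta>. \<zeta> \<in> ball 0 1 \<Longrightarrow> f \<zeta> \<in> ball 0 1"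
    for f :: "complex \<Rightarrow> complex ^ 'n" and k
  proof -
    have h: "(\<lambda>\<zeta>. hermitian_product (f \<zeta>) a) holomorphic_on ball 0 1"
      unfolding hermitian_product_def by (intro holomorphic_intros f)
    show ?thesis
      unfolding ball_involution_def Let_def vector_smult_component vector_minus_component divide_inverse
      by (intro holomorphic_intros f h one_minus_hermitian_product_nonzero im)
  qed
  moreover have "ball_involution a x \<in> ball 0 1" if "x \<in> ball 0 1" for x
    using that by (rule ball_involution_in_ball)
  ultimately show ?thesis
    unfolding preserves_holomorphic_discs_def holomorphic_disc_def by (simp add: image_subset_iff)
qed

end

lemma chain_lengths_ball_nonempty:
  assumes "x \<in> ball 0 1" "y \<in> ball 0 1"
  shows "chain_lengths (ball 0 1) x y \<noteq> {}"
  using chain_lengths_preserves[OF ball_involution_preserves_holomorphic_discs[OF assms(1)],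
      of 0 "ball_involution x y"]
    kobayashi_ball_0(1)[OF ball_involution_in_ball[OF assms]] assms
  by (auto simp: ball_involution_0 ball_involution_involution)

text \<open>An involution that does not increase the distance preserves it.\<close>

lemma kobayashi_dist_ball_involution:
  assumes "a \<in> ball 0 1" "x \<in> ball 0 1" "y \<in> ball 0 1"
  shows "kobayashi_dist (ball 0 1) (ball_involution a x) (ball_involution a y) = kobayashi_dist (ball 0 1) x y"
proof -
  have le: "kobayashi_dist (ball 0 1) (ball_involution a x) (ball_involution a y) \<le> kobayashi_dist (ball 0 1) x y"
    if "x \<in> ball 0 1" "y \<in> ball 0 1" for x y
    by (rule kobayashi_dist_le[OF ball_involution_preserves_holomorphic_discs[OF assms(1)]
          chain_lengths_ball_nonempty[OF that]])
  show ?thesis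
    using le[OF assms(2,3)] le[OF assms(1)[THEN ball_involution_in_ball, OF assms(2)] assms(1)[THEN ball_involution_in_ball, OF assms(3)]]
    unfolding assms(2,3)[THEN ball_involution_involution[OF assms(1)]] by (rule antisym)
qed

text \<open>Moving \<open>x\<close> to the origin leaves only a distance from the origin.\<close>

lemma kobayashi_dist_ball:
  assumes "x \<in> ball 0 1" "y \<in> ball 0 1"
  shows "kobayashi_dist (ball 0 1) x y =
    artanh (sqrt (1 - (1 - (norm x)\<^sup>2) * (1 - (norm y)\<^sup>2) / (cmod (1 - hermitian_product y x))\<^sup>2))"
proof -
  have "kobayashi_dist (ball 0 1) x y = kobayashi_dist (ball 0 1) 0 (ball_involution x y)"
    using kobayashi_dist_ball_involution[OF assms(1) assms] by (simp add: ball_involution_self[OF assms(1)])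
  also have "\<dots> = artanh (norm (ball_involution x y))"
    by (rule kobayashi_ball_0(2)[OF ball_involution_in_ball[OF assms]])
  also have "norm (ball_involution x y) = 
    sqrt (1 - (1 - (norm x)\<^sup>2) * (1 - (norm y)\<^sup>2) / (cmod (1 - hermitian_product y x))\<^sup>2)"
    using norm_ball_involution[OF assms] by (intro real_sqrt_unique[symmetric]) auto
  finally show ?thesis .
qed

section \<open>Recognising the ends of a non-Euclidean line\<close>

lemma cpart_of_real [simp]: "cpart (of_real r) = of_real r"
  by (simp add: of_real_def)

lemma not_connected_component_across_hyperplane:
  fixes n :: "'a::euclidean_space"
  assumes "\<And>z. z \<in> S \<Longrightarrow> n \<bullet> z \<noteq> k" "n \<bullet> b < k" "k < n \<bullet> d"
  shows "\<not> connected_component S b d"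
proof
  assume "connected_component S b d"
  then obtain T where T: "connected T" "T \<subseteq> S" "b \<in> T" "d \<in> T"
    by (auto simp: connected_component_def)
  then obtain z where "z \<in> T" "n \<bullet> z = k"
    using connected_ivt_hyperplane[of T b d n k] assms by (auto simp: less_imp_le)
  then show False using T assms(1) by auto
qed

text \<open>Which of the two ends comes after \<open>b\<close> is decided by two facts: \<open>a\<close> and \<open>c\<close> separate \<open>b\<close> from \<open>d\<close>,
  while \<open>a\<close> and \<open>d\<close> do not separate \<open>b\<close> from \<open>c\<close>. The second one excludes the opposite naming.\<close>

lemma line_ends_eqI:
  assumes L: "noneuclidean_line a b = L" and "L \<inter> sphere 0 1 = {c, d}"
    and "a \<in> L" "b \<in> L" "distinct [a, b, c, d]"
    and "\<not> connected_component (L - {a, c}) b d"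
    and con: "connected_component (L - {a, d}) b c"
  shows "line_ends a b = (c, d)"
  unfolding line_ends_def L
proof (rule the_equality)
  show "case (c, d) of (q3, q4) \<Rightarrow> L \<inter> sphere 0 1 = {q3, q4} \<and> cyclically_arranged_on L a b q3 q4"
    using assms by (auto simp: cyclically_arranged_on_def)
  fix p assume "case p of (q3, q4) \<Rightarrow> L \<inter> sphere 0 1 = {q3, q4} \<and> cyclically_arranged_on L a b q3 q4"
  then obtain q3 q4 where p: "p = (q3, q4)" and q: "{c, d} = {q3, q4}" "cyclically_arranged_on L a b q3 q4"
    using assms(2) by (cases p) auto
  have "(q3, q4) \<noteq> (d, c)"
    using q(2) con by (auto simp: cyclically_arranged_on_def)
  then show "p = (c, d)"
    using q(1) p by (auto simp: doubleton_eq_iff)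
qed

section \<open>Distances along a diameter\<close>

lemma mem_closed_segment_uminus_iff:
  fixes u :: "'a::real_normed_vector"
  shows "z \<in> closed_segment (- u) u \<longleftrightarrow> (\<exists>s. \<bar>s\<bar> \<le> 1 \<and> z = s *\<^sub>R u)"
proof
  assume "z \<in> closed_segment (- u) u"
  then obtain m where m: "0 \<le> m" "m \<le> 1" "z = (1 - m) *\<^sub>R (- u) + m *\<^sub>R u"
    by (auto simp: closed_segment_def)
  then have "z = (2 * m - 1) *\<^sub>R u" by (simp add: algebra_simps scaleR_2 flip: scaleR_scaleR)
  then show "\<exists>s. \<bar>s\<bar> \<le> 1 \<and> z = s *\<^sub>R u" using m by (intro exI[of _ "2 * m - 1"]) auto
next
  assume "\<exists>s. \<bar>s\<bar> \<le> 1 \<and> z = s *\<^sub>R u"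
  then obtain s where s: "\<bar>s\<bar> \<le> 1" "z = s *\<^sub>R u" by blast
  have "z = (1 - (1 + s) / 2) *\<^sub>R (- u) + ((1 + s) / 2) *\<^sub>R u"
    unfolding s scaleR_minus_right scaleR_minus_left[symmetric] scaleR_left_distrib[symmetric] by (simp add: field_simps)
  then show "z \<in> closed_segment (- u) u"
    using s(1) unfolding closed_segment_def by (intro CollectI exI[of _ "(1 + s) / 2"]) auto
qed

context
  fixes u :: quat and \<alpha> \<beta> :: real
  assumes u: "norm u = 1" and \<alpha>: "-1 < \<alpha>" and \<alpha>\<beta>: "\<alpha> < \<beta>" and \<beta>: "\<beta> < 1"
begin

lemma diameter_points_dependent: "dependent {\<alpha> *\<^sub>R u, \<beta> *\<^sub>R u}"
proof (cases "\<alpha> = 0")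
  case True
  then show ?thesis by (simp add: dependent_zero)
next
  case False
  have "\<beta> *\<^sub>R u = (\<beta> / \<alpha>) *\<^sub>R (\<alpha> *\<^sub>R u)" using False by simp
  moreover have "\<alpha> *\<^sub>R u \<in> {\<alpha> *\<^sub>R u, \<beta> *\<^sub>R u} - {\<beta> *\<^sub>R u}" using \<alpha>\<beta> u by auto
  ultimately have "\<beta> *\<^sub>R u \<in> span ({\<alpha> *\<^sub>R u, \<beta> *\<^sub>R u} - {\<beta> *\<^sub>R u})"
    by (metis span_base span_scale)
  then show ?thesis unfolding dependent_def by blast
qed

lemma noneuclidean_line_diameter:
  "noneuclidean_line (\<alpha> *\<^sub>R u) (\<beta> *\<^sub>R u) = closed_segment (- u) u"
  unfolding noneuclidean_line_def if_P[OF diameter_points_dependent]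
proof (rule the_equality)
  show "\<alpha> *\<^sub>R u \<in> closed_segment (- u) u \<and> \<beta> *\<^sub>R u \<in> closed_segment (- u) u \<and> is_diameter (closed_segment (- u) u)"
    using u \<alpha> \<alpha>\<beta> \<beta> unfolding mem_closed_segment_uminus_iff is_diameter_def by force
  fix L assume L: "\<alpha> *\<^sub>R u \<in> L \<and> \<beta> *\<^sub>R u \<in> L \<and> is_diameter L"
  then obtain v where v: "norm v = 1" "L = closed_segment (- v) v"
    by (auto simp: is_diameter_def)
  obtain \<gamma> where \<gamma>: "\<gamma> \<noteq> 0" "\<gamma> *\<^sub>R u \<in> L" using L \<alpha>\<beta> by (metis order_less_irrefl)
  then obtain s where s: "\<gamma> *\<^sub>R u = s *\<^sub>R v" by (auto simp: v mem_closed_segment_uminus_iff)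
  then have "norm (\<gamma> *\<^sub>R u) = norm (s *\<^sub>R v)" by simp
  then have "\<bar>\<gamma>\<bar> = \<bar>s\<bar>" by (simp add: u v)
  then have "s = \<gamma> \<or> s = - \<gamma>" by linarith
  then have "v = u \<or> v = - u"
    using s \<gamma>(1) by (metis add.inverse_inverse scaleR_cancel_left scaleR_minus_left scaleR_minus_right)
  then show "L = closed_segment (- u) u"
    by (auto simp: v closed_segment_commute)
qed

lemma line_ends_diameter: "line_ends (\<alpha> *\<^sub>R u) (\<beta> *\<^sub>R u) = (u, - u)"
proof (rule line_ends_eqI[OF noneuclidean_line_diameter])
  have [simp]: "u \<noteq> 0" using u by auto
  have inj: "s *\<^sub>R u = u \<longleftrightarrow> s = 1" "s *\<^sub>R u = - u \<longleftrightarrow> s = -1" for s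
    by (metis \<open>u \<noteq> 0\<close> scaleR_cancel_right scaleR_one)
       (metis \<open>u \<noteq> 0\<close> scaleR_cancel_right scaleR_one scaleR_minus_left)
  show "closed_segment (- u) u \<inter> sphere 0 1 = {u, - u}"
    using u by (auto simp: mem_closed_segment_uminus_iff abs_if split: if_splits intro: exI[of _ 1] exI[of _ "-1"])
  show "\<alpha> *\<^sub>R u \<in> closed_segment (- u) u" "\<beta> *\<^sub>R u \<in> closed_segment (- u) u"
    using u \<alpha> \<alpha>\<beta> \<beta> unfolding mem_closed_segment_uminus_iff by force+
  have "- u \<noteq> u" using inj(1)[of "-1"] by simp
  then show "distinct [\<alpha> *\<^sub>R u, \<beta> *\<^sub>R u, u, - u]"
    using inj \<alpha> \<alpha>\<beta> \<beta> by auto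
  have uu: "u \<bullet> u = 1" using u by (simp add: norm_eq_1)
  show "\<not> connected_component (closed_segment (- u) u - {\<alpha> *\<^sub>R u, u}) (\<beta> *\<^sub>R u) (- u)"
    by (rule not_connected_component_across_hyperplane[of _ "- u" "- \<alpha>"])
       (use \<alpha> \<alpha>\<beta> in \<open>auto simp: uu mem_closed_segment_uminus_iff\<close>)
  have "closed_segment (\<beta> *\<^sub>R u) u \<subseteq> closed_segment (- u) u - {\<alpha> *\<^sub>R u, - u}"
  proof
    fix z assume "z \<in> closed_segment (\<beta> *\<^sub>R u) u"
    then obtain m where m: "0 \<le> m" "m \<le> 1" "z = (1 - m) *\<^sub>R (\<beta> *\<^sub>R u) + m *\<^sub>R u"
      by (auto simp: closed_segment_def)
    define s where "s = (1 - m) * \<beta> + m"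
    have z: "z = s *\<^sub>R u" using m by (simp add: s_def scaleR_left_distrib)
    have "s - \<beta> = m * (1 - \<beta>)" "1 - s = (1 - m) * (1 - \<beta>)" by (simp_all add: s_def algebra_simps)
    then have "0 \<le> s - \<beta>" "0 \<le> 1 - s" using m \<beta> by simp_all
    then show "z \<in> closed_segment (- u) u - {\<alpha> *\<^sub>R u, - u}"
      using \<alpha> \<alpha>\<beta> inj(2)[of s] unfolding z by (auto simp: mem_closed_segment_uminus_iff)
  qed
  then show "connected_component (closed_segment (- u) u - {\<alpha> *\<^sub>R u, - u}) (\<beta> *\<^sub>R u) u"
    unfolding connected_component_def by (intro exI[of _ "closed_segment (\<beta> *\<^sub>R u) u"]) auto
qed

lemma quat_poincare_dist_diameter:
  "quat_poincare_dist (\<alpha> *\<^sub>R u) (\<beta> *\<^sub>R u) = artanh ((\<beta> - \<alpha>) / (1 - \<alpha> * \<beta>))"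
proof -
  have [simp]: "u \<noteq> 0" using u by auto
  have uw: "s *\<^sub>R u * inverse (w *\<^sub>R u) = of_real (s / w)" for s w
    by (simp add: of_real_def divide_inverse inverse_scaleR_distrib)
  have e: "\<alpha> *\<^sub>R u - u = (\<alpha> - 1) *\<^sub>R u" "\<beta> *\<^sub>R u - u = (\<beta> - 1) *\<^sub>R u"
    "\<alpha> *\<^sub>R u - - u = (\<alpha> + 1) *\<^sub>R u" "\<beta> *\<^sub>R u - - u = (\<beta> + 1) *\<^sub>R u"
    by (simp_all add: algebra_simps)
  have "cross_ratio (\<alpha> *\<^sub>R u) (\<beta> *\<^sub>R u) u (- u) = of_real ((\<alpha> - 1) / (\<alpha> + 1)) * of_real ((\<beta> + 1) / (\<beta> - 1))"
    unfolding cross_ratio_def e mult.assoc uw by (simp add: uw flip: mult.assoc)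
  then have cr: "cross_ratio (\<alpha> *\<^sub>R u) (\<beta> *\<^sub>R u) u (- u) = of_real ((\<alpha> - 1) / (\<alpha> + 1) * ((\<beta> + 1) / (\<beta> - 1)))"
    by (simp only: of_real_mult)
  have p: "1 - \<alpha> * \<beta> > 0"
  proof -
    have "\<bar>\<alpha>\<bar> * \<bar>\<beta>\<bar> < 1 * 1" using \<alpha> \<alpha>\<beta> \<beta> by (intro mult_strict_mono') auto
    then show ?thesis by (simp flip: abs_mult)
  qed
  have "(1 + (\<beta> - \<alpha>) / (1 - \<alpha> * \<beta>)) / (1 - (\<beta> - \<alpha>) / (1 - \<alpha> * \<beta>)) = ((1 - \<alpha>) * (1 + \<beta>)) / ((1 + \<alpha>) * (1 - \<beta>))"
  proof -
    have "1 + (\<beta> - \<alpha>) / (1 - \<alpha> * \<beta>) = ((1 - \<alpha>) * (1 + \<beta>)) / (1 - \<alpha> * \<beta>)"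
      "1 - (\<beta> - \<alpha>) / (1 - \<alpha> * \<beta>) = ((1 + \<alpha>) * (1 - \<beta>)) / (1 - \<alpha> * \<beta>)"
      using p by (simp_all add: field_simps)
    then show ?thesis using p by simp
  qed
  also have "\<dots> = (\<alpha> - 1) / (\<alpha> + 1) * ((\<beta> + 1) / (\<beta> - 1))"
    using \<alpha> \<beta> by (simp add: divide_simps) (simp add: algebra_simps)
  finally show ?thesis
    using \<alpha>\<beta> by (simp add: quat_poincare_dist_def line_ends_diameter cr artanh_def del: of_real_mult of_real_divide)
qed

end

lemma quat_poincare_dist_0:
  assumes "a \<in> ball 0 1"
  shows "quat_poincare_dist 0 a = artanh (norm a)"
proof (cases "a = 0")
  case True
  then show ?thesis by (simp add: quat_poincare_dist_def)
next
  case False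
  then show ?thesis
    using quat_poincare_dist_diameter[of "sgn a" 0 "norm a"] assms
    by (simp add: norm_sgn sgn_div_norm)
qed

section \<open>Uniqueness of the orthogonal circle through two points\<close>

text \<open>At a point \<open>z\<close> where the circle meets the unit sphere, the tangent vector of the circle is orthogonal
  to everything that is orthogonal to \<open>z\<close>, hence parallel to \<open>z\<close>. So \<open>z\<close>, and with it the centre \<open>c\<close>,
  lies in the linear plane of directions: the circle is contained in a plane through the origin. The
  radius \<open>z - c\<close> is orthogonal to \<open>z\<close>, so \<open>r\<^sup>2 = \<bar>c\<bar>\<^sup>2 - 1\<close>, and the equation \<open>\<bar>q - c\<bar> = r\<close> becomes the
  affine condition \<open>2 \<langle>q, c\<rangle> = \<bar>q\<bar>\<^sup>2 + 1\<close> on \<open>c\<close>.\<close>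

lemma orthogonal_circle_through:
  assumes C: "is_orthogonal_circle C" and xy: "x \<in> C" "y \<in> C" "x \<noteq> y" "independent {x, y}"
  obtains c where "c \<in> span {x, y}" "2 * (x \<bullet> c) = x \<bullet> x + 1" "2 * (y \<bullet> c) = y \<bullet> y + 1"
    "C = {z \<in> span {x, y}. 2 * (z \<bullet> c) = z \<bullet> z + 1}"
proof -
  obtain c r P where P: "0 < r" "subspace P" "dim P = 2" and Cdef: "C = {x. x - c \<in> P \<and> norm (x - c) = r}"
    and ne: "C \<inter> sphere 0 1 \<noteq> {}"
    and orth: "\<And>x v w. x \<in> C \<inter> sphere 0 1 \<Longrightarrow> v \<in> P \<Longrightarrow>
          orthogonal v (x - c) \<Longrightarrow> orthogonal w x \<Longrightarrow> orthogonal v w"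
    using C unfolding is_orthogonal_circle_def by blast
  from ne obtain z where z: "z \<in> C" "norm z = 1" by auto
  have zz: "z \<bullet> z = 1" using z by (simp add: norm_eq_1)
  have zc: "z - c \<in> P" "norm (z - c) = r" using z Cdef by auto
  have "span {z - c} \<subset> span P"
  proof -
    have "dim (span {z - c}) \<noteq> dim (span P)"
      using P by (simp add: dim_singleton)
    moreover have "span {z - c} \<subseteq> span P"
      using zc(1) by (intro span_mono) simp
    ultimately show ?thesis by (metis psubsetI)
  qed
  then obtain v where v: "v \<noteq> 0" "v \<in> span P" "\<And>y. y \<in> span {z - c} \<Longrightarrow> orthogonal v y"
    by (rule orthogonal_to_subspace_exists_gen) blast
  then have v: "v \<noteq> 0" "v \<in> P" "orthogonal v (z - c)"
    unfolding span_eq_iff[THEN iffD2, OF P(2)] by (auto simp: span_base)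
  define w where "w = v - (v \<bullet> z) *\<^sub>R z"
  have "orthogonal w z" by (simp add: w_def orthogonal_def inner_diff_left zz)
  then have "orthogonal v w" using orth z v by simp
  moreover have "w \<bullet> w = v \<bullet> w - (v \<bullet> z) * (w \<bullet> z)"
    unfolding w_def by (simp add: inner_diff inner_commute algebra_simps)
  ultimately have "w \<bullet> w = 0"
    using \<open>orthogonal w z\<close> by (simp add: orthogonal_def)
  then have "w = 0" by simp
  then have vz: "v = (v \<bullet> z) *\<^sub>R z"
    unfolding w_def by (rule eq_iff_diff_eq_0[THEN iffD2])
  have "v \<bullet> z \<noteq> 0" using vz v(1) by (metis scaleR_zero_left)
  then have "z = inverse (v \<bullet> z) *\<^sub>R v"
    using arg_cong[OF vz, of "\<lambda>a. inverse (v \<bullet> z) *\<^sub>R a"] by simp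
  then have zP: "z \<in> P" using subspace_scale[OF P(2) v(2)] by metis
  then have cP: "c \<in> P" using subspace_diff[OF P(2) zP zc(1)] by simp
  have "z \<bullet> (z - c) = 0"
    using v(3) \<open>v \<bullet> z \<noteq> 0\<close> arg_cong[OF vz, of "\<lambda>a. a \<bullet> (z - c)"]
    by (simp add: orthogonal_def)
  then have c1: "z \<bullet> c = 1" by (simp add: inner_diff_right zz)
  have r2: "r\<^sup>2 = c \<bullet> c - 1"
    using zc(2) c1 zz by (auto simp: power2_norm_eq_inner inner_diff inner_commute)
  have circ: "norm (q - c) = r \<longleftrightarrow> 2 * (q \<bullet> c) = q \<bullet> q + 1" for q
  proof -
    have "norm (q - c) = r \<longleftrightarrow> (norm (q - c))\<^sup>2 = r\<^sup>2"
      using P by (simp add: power2_eq_iff_nonneg)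
    also have "\<dots> \<longleftrightarrow> 2 * (q \<bullet> c) = q \<bullet> q + 1"
      unfolding r2 by (auto simp: power2_norm_eq_inner inner_diff inner_commute)
    finally show ?thesis .
  qed
  have inP: "q - c \<in> P \<longleftrightarrow> q \<in> P" for q
    using subspace_add[OF P(2) _ cP, of "q - c"] subspace_diff[OF P(2) _ cP, of q] by auto
  have "span {x, y} = P"
  proof -
    have "span {x, y} \<subseteq> P"
      using xy inP P by (intro span_minimal) (auto simp: Cdef)
    moreover have "dim (span {x, y}) = 2"
      using xy by (simp add: dim_eq_card_independent)
    ultimately show ?thesis
      using P by (intro subspace_dim_equal) auto
  qed
  moreover have "C = {z \<in> P. 2 * (z \<bullet> c) = z \<bullet> z + 1}"
    unfolding Cdef inP circ ..
  ultimately show thesis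
    using that[of c] xy(1,2) cP by simp
qed

text \<open>Two independent points impose two affine conditions on the centre in the plane they span.\<close>

lemma orthogonal_circle_unique:
  assumes "is_orthogonal_circle C" "is_orthogonal_circle C'" "x \<in> C" "y \<in> C" "x \<in> C'" "y \<in> C'"
    and "x \<noteq> y" "independent {x, y}"
  shows "C = C'"
proof -
  obtain c where c: "c \<in> span {x, y}" "2 * (x \<bullet> c) = x \<bullet> x + 1" "2 * (y \<bullet> c) = y \<bullet> y + 1"
    "C = {z \<in> span {x, y}. 2 * (z \<bullet> c) = z \<bullet> z + 1}"
    by (rule orthogonal_circle_through[OF assms(1,3,4,7,8)])
  obtain c' where c': "c' \<in> span {x, y}" "2 * (x \<bullet> c') = x \<bullet> x + 1" "2 * (y \<bullet> c') = y \<bullet> y + 1"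
    "C' = {z \<in> span {x, y}. 2 * (z \<bullet> c') = z \<bullet> z + 1}"
    by (rule orthogonal_circle_through[OF assms(2,5,6,7,8)])
  have "orthogonal (c - c') q" if "q \<in> {x, y}" for q
  proof -
    have "q \<bullet> c = q \<bullet> c'" using that c(2,3) c'(2,3) by auto
    then show ?thesis by (simp add: orthogonal_def inner_commute[of _ q] inner_diff_right)
  qed
  then have "orthogonal (c - c') (c - c')"
    by (intro orthogonal_to_span[OF span_diff[OF c(1) c'(1)]])
  then have "c = c'" by (simp add: orthogonal_self)
  then show ?thesis using c c' by simp
qed

section \<open>The orthogonal circle through two points of equal norm\<close>

text \<open>Two points of equal norm are mirror images in the direction of their sum. In the orthonormal frame
  given by the directions of their sum and difference they are \<open>(A, B)\<close> and \<open>(A, - B)\<close>, and the circle,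
  its ends and the cross-ratio have short explicit formulas.\<close>

context
  fixes e1 e2 :: quat
  assumes e1: "norm e1 = 1" and e2: "norm e2 = 1" and e12: "e1 \<bullet> e2 = 0"
begin

definition plane_pt :: "real \<Rightarrow> real \<Rightarrow> quat" where "plane_pt s \<tau> = s *\<^sub>R e1 + \<tau> *\<^sub>R e2"

lemma frame_inner: "e1 \<bullet> e1 = 1" "e2 \<bullet> e2 = 1" "e1 \<bullet> e2 = 0" "e2 \<bullet> e1 = 0"
  using e1 e2 e12 by (simp_all add: norm_eq_1 inner_commute)

lemma inner_plane_pt: "plane_pt s \<tau> \<bullet> plane_pt s' \<tau>' = s * s' + \<tau> * \<tau>'"
  by (simp add: plane_pt_def inner_add frame_inner)

lemma plane_pt_eq_iff: "plane_pt s \<tau> = plane_pt s' \<tau>' \<longleftrightarrow> s = s' \<and> \<tau> = \<tau>'"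
proof
  assume "plane_pt s \<tau> = plane_pt s' \<tau>'"
  then have "plane_pt s \<tau> \<bullet> plane_pt 1 0 = plane_pt s' \<tau>' \<bullet> plane_pt 1 0" "plane_pt s \<tau> \<bullet> plane_pt 0 1 = plane_pt s' \<tau>' \<bullet> plane_pt 0 1" by simp_all
  then show "s = s' \<and> \<tau> = \<tau>'" by (simp add: inner_plane_pt)
qed simp

lemma plane_pt_simps: "plane_pt s \<tau> - plane_pt s' \<tau>' = plane_pt (s - s') (\<tau> - \<tau>')" "k *\<^sub>R plane_pt s \<tau> = plane_pt (k * s) (k * \<tau>)"
  by (simp_all add: plane_pt_def algebra_simps)

lemma norm_plane_pt: "norm (plane_pt s \<tau>) = sqrt (s\<^sup>2 + \<tau>\<^sup>2)"
  by (simp add: norm_eq_sqrt_inner inner_plane_pt power2_eq_square)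

lemma mem_frame_plane_iff: "z \<in> span {e1, e2} \<longleftrightarrow> (\<exists>s \<tau>. z = plane_pt s \<tau>)"
proof
  assume "z \<in> span {e1, e2}"
  then obtain s where "z - s *\<^sub>R e1 \<in> span {e2}"
    using span_breakdown_eq by blast
  then obtain \<tau> where "z - s *\<^sub>R e1 = \<tau> *\<^sub>R e2" by (auto simp: span_singleton)
  then show "\<exists>s \<tau>. z = plane_pt s \<tau>" by (metis add.commute diff_eq_eq plane_pt_def)
next
  assume "\<exists>s \<tau>. z = plane_pt s \<tau>"
  then show "z \<in> span {e1, e2}" unfolding plane_pt_def by (metis insertCI span_add span_base span_scale)
qed

lemma dim_frame_plane: "dim (span {e1, e2}) = 2"
proof -
  have "e1 \<noteq> e2" using frame_inner by force
  moreover have "independent {e1, e2}"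
    using frame_inner by (intro pairwise_orthogonal_independent) (auto simp: pairwise_def orthogonal_def)
  ultimately show ?thesis by (simp add: dim_eq_card_independent)
qed

text \<open>The quaternion \<open>E = e2 e1\<inverse>\<close> satisfies \<open>E\<^sup>2 = -1\<close>, and each point of the plane is \<open>(\<mu> + a E) e1\<close>.
  The factors \<open>e1\<close> cancel in the product, and what remains is a cross-ratio in the commutative field
  spanned by \<open>1\<close> and \<open>E\<close>. This is the reason why cross-ratios of plane figures behave as they
  do over the complex numbers.\<close>

lemma frame_cross_ratio:
  assumes "\<mu>\<^sup>2 + d\<^sup>2 \<noteq> 0"
  shows "plane_pt \<mu> s * inverse (plane_pt \<mu> d) * plane_pt \<mu> (- s) * inverse (plane_pt \<mu> (- d)) = of_real ((\<mu>\<^sup>2 + s\<^sup>2) / (\<mu>\<^sup>2 + d\<^sup>2))"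
proof -
  define E where "E = e2 * inverse e1"
  define F where "F = (\<lambda>a. of_real \<mu> + a *\<^sub>R E)"
  have e1nz: "e1 \<noteq> 0" using e1 by auto
  have "Re (cpart E) = 0"
    using e12 e1 by (simp add: E_def inverse_quat_def inner_quat_def inner_complex_def algebra_simps)
  moreover have "norm E = 1" using e1 e2 by (simp add: E_def norm_mult norm_inverse)
  ultimately have EE: "E * E = - 1"
  proof -
    assume re: "Re (cpart E) = 0" and "norm E = 1"
    then have "(norm E)\<^sup>2 = 1" by simp
    then have "(Re (cpart E))\<^sup>2 + (Im (cpart E))\<^sup>2 + ((Re (jpart E))\<^sup>2 + (Im (jpart E))\<^sup>2) = 1"
      unfolding norm_quat_squared cmod_power2 by simp
    then show "E * E = - 1"
      using re by (auto simp: quat_eq_iff complex_eq_iff power2_eq_square algebra_simps)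
  qed
  have pF: "plane_pt \<mu> a = F a * e1" for a
    using e1nz by (simp add: plane_pt_def F_def E_def of_real_def distrib_right mult.assoc)
  have FF: "F a * F b = of_real (\<mu> * \<mu> - a * b) + (\<mu> * (a + b)) *\<^sub>R E" for a b
    by (simp add: F_def of_real_def EE algebra_simps)
  have FFm: "F a * F (- a) = of_real (\<mu>\<^sup>2 + a\<^sup>2)" for a
    by (simp add: FF power2_eq_square)
  have comm: "F a * F b = F b * F a" for a b by (simp add: FF algebra_simps)
  define N where "N = \<mu>\<^sup>2 + d\<^sup>2"
  have N: "N \<noteq> 0" using assms by (simp add: N_def)
  have inv: "inverse (F d) = inverse N *\<^sub>R F (- d)" "inverse (F (- d)) = inverse N *\<^sub>R F d"
    using N FFm[of d] FFm[of "- d"] by (auto intro!: inverse_unique simp: N_def of_real_def)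
  have nz: "F d \<noteq> 0" "F (- d) \<noteq> 0"
    using N FFm[of d] by (auto simp flip: N_def)
  have q: "plane_pt \<mu> a * inverse (plane_pt \<mu> b) = F a * inverse (F b)" if "F b \<noteq> 0" for a b
    using e1nz that by (simp add: pF nonzero_inverse_mult_distrib mult.assoc) (simp flip: mult.assoc)
  have "plane_pt \<mu> s * inverse (plane_pt \<mu> d) * plane_pt \<mu> (- s) * inverse (plane_pt \<mu> (- d)) =
      (F s * inverse (F d)) * (F (- s) * inverse (F (- d)))"
    unfolding q[OF nz(1), symmetric] q[OF nz(2), symmetric] by (simp add: mult.assoc)
  also have "\<dots> = (inverse N * inverse N) *\<^sub>R (F s * (F (- d) * F (- s)) * F d)"
    unfolding inv by (simp add: mult.assoc)
  also have "F s * (F (- d) * F (- s)) * F d = (F s * F (- s)) * (F (- d) * F d)"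
    unfolding comm[of "- d" "- s"] by (simp add: mult.assoc)
  also have "\<dots> = of_real ((\<mu>\<^sup>2 + s\<^sup>2) * N)"
    using FFm[of "- d"] by (simp add: FFm N_def)
  also have "(inverse N * inverse N) *\<^sub>R (of_real ((\<mu>\<^sup>2 + s\<^sup>2) * N) :: quat) = of_real ((\<mu>\<^sup>2 + s\<^sup>2) / N)"
    using N by (simp add: of_real_def divide_inverse)
  finally show ?thesis by (simp add: N_def)
qed

context
  fixes A B :: real
  assumes A: "0 < A" and B: "0 < B" and AB: "A\<^sup>2 + B\<^sup>2 < 1"
begin

text \<open>The ends are \<open>(end_x, \<plusminus> end_y)\<close>. A circle orthogonal to the unit circle has its centre where the
  tangents at the ends meet, at \<open>(1 / end_x, 0)\<close>, and its radius is the tangent length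
  \<open>end_y / end_x\<close>. The value of \<open>end_x\<close> makes it pass through \<open>(A, B)\<close>.\<close>

definition "end_x = 2 * A / (1 + A\<^sup>2 + B\<^sup>2)"
definition "end_y = sqrt (1 - end_x\<^sup>2)"
definition "orth_circle = {z. z - plane_pt (1 / end_x) 0 \<in> span {e1, e2} \<and> norm (z - plane_pt (1 / end_x) 0) = end_y / end_x}"

lemma end_x_facts: "0 < end_x" "end_x < 1" "A < end_x" "end_x * (A\<^sup>2 + B\<^sup>2 + 1) = 2 * A"
proof -
  have pos: "0 < 1 + A\<^sup>2 + B\<^sup>2" by (simp add: add_pos_nonneg)
  show "0 < end_x" using A pos by (simp add: end_x_def)
  show pe: "end_x * (A\<^sup>2 + B\<^sup>2 + 1) = 2 * A" using pos by (simp add: end_x_def field_simps)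
  have "0 < (1 - A)\<^sup>2 + B\<^sup>2" using B by (simp add: add_nonneg_pos)
  then show "end_x < 1" using pos by (simp add: end_x_def field_simps power2_eq_square)
  have "A * (1 + A\<^sup>2 + B\<^sup>2) < A * 2" using A AB by (intro mult_strict_left_mono) auto
  then show "A < end_x" using pos by (simp add: end_x_def field_simps)
qed

lemma end_y_facts: "0 < end_y" "end_y\<^sup>2 = 1 - end_x\<^sup>2"
proof -
  have "end_x\<^sup>2 < 1" using end_x_facts by (simp add: abs_square_less_1)
  then show "0 < end_y" "end_y\<^sup>2 = 1 - end_x\<^sup>2" by (simp_all add: end_y_def)
qed

text \<open>The square norm of the centre exceeds the square of the radius by \<open>1\<close>, so the constant terms of the
  equation of the circle combine to \<open>1\<close>.\<close>

lemma mem_orth_circle_iff: "z \<in> orth_circle \<longleftrightarrow> (\<exists>s \<tau>. z = plane_pt s \<tau> \<and> end_x * (s\<^sup>2 + \<tau>\<^sup>2 + 1) = 2 * s)"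
proof -
  have plane: "z - plane_pt (1 / end_x) 0 \<in> span {e1, e2} \<longleftrightarrow> z \<in> span {e1, e2}"
    by (metis diff_add_cancel mem_frame_plane_iff span_add span_diff)
  have radius: "norm (plane_pt s \<tau> - plane_pt (1 / end_x) 0) = end_y / end_x \<longleftrightarrow> end_x * (s\<^sup>2 + \<tau>\<^sup>2 + 1) = 2 * s" for s \<tau>
  proof -
    have "norm (plane_pt s \<tau> - plane_pt (1 / end_x) 0) = end_y / end_x \<longleftrightarrow> (norm (plane_pt s \<tau> - plane_pt (1 / end_x) 0))\<^sup>2 = (end_y / end_x)\<^sup>2"
      using end_x_facts end_y_facts by (simp add: power2_eq_iff_nonneg)
    also have "\<dots> \<longleftrightarrow> (s - 1 / end_x)\<^sup>2 + \<tau>\<^sup>2 = (1 - end_x\<^sup>2) / end_x\<^sup>2"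
      by (simp add: plane_pt_simps norm_plane_pt power_divide end_y_facts)
    also have "\<dots> \<longleftrightarrow> end_x\<^sup>2 * ((s - 1 / end_x)\<^sup>2 + \<tau>\<^sup>2) = 1 - end_x\<^sup>2"
      using end_x_facts by (simp add: eq_divide_eq mult.commute)
    also have "end_x\<^sup>2 * ((s - 1 / end_x)\<^sup>2 + \<tau>\<^sup>2) = end_x * (end_x * (s\<^sup>2 + \<tau>\<^sup>2 + 1) - 2 * s) + 1 - end_x\<^sup>2"
      using end_x_facts by (simp add: field_simps power2_eq_square)
    finally show ?thesis using end_x_facts by simp
  qed
  show ?thesis
    unfolding orth_circle_def mem_Collect_eq plane unfolding mem_frame_plane_iff using radius by auto
qed

lemma orth_circle_sphere: "orth_circle \<inter> sphere 0 1 = {plane_pt end_x (- end_y), plane_pt end_x end_y}"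
proof -
  have "s = end_x \<and> (\<tau> = end_y \<or> \<tau> = - end_y)" if "end_x * (s\<^sup>2 + \<tau>\<^sup>2 + 1) = 2 * s" "s\<^sup>2 + \<tau>\<^sup>2 = 1" for s \<tau>
  proof -
    have s: "s = end_x" using that(1) unfolding that(2) by simp
    then have "\<tau>\<^sup>2 = end_y\<^sup>2" using that end_y_facts by simp
    then show ?thesis using s by (simp add: power2_eq_iff)
  qed
  moreover have "end_x * (end_x\<^sup>2 + end_y\<^sup>2 + 1) = 2 * end_x" using end_y_facts by simp
  then have "plane_pt end_x end_y \<in> orth_circle" "plane_pt end_x (- end_y) \<in> orth_circle"
    unfolding mem_orth_circle_iff by (metis power2_minus)+
  moreover have "norm (plane_pt end_x end_y) = 1" "norm (plane_pt end_x (- end_y)) = 1" using end_y_facts by (simp_all add: norm_plane_pt)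
  ultimately show ?thesis
    by (fastforce simp: mem_orth_circle_iff norm_plane_pt)
qed

lemma is_orthogonal_circle_orth_circle: "is_orthogonal_circle orth_circle"
proof -
  have "orthogonal v w"
    if x: "x \<in> orth_circle \<inter> sphere 0 1" and v: "v \<in> span {e1, e2}" "orthogonal v (x - plane_pt (1 / end_x) 0)" and w: "orthogonal w x" for x v w
  proof -
    obtain \<tau> where t: "x = plane_pt end_x \<tau>" "\<tau>\<^sup>2 = 1 - end_x\<^sup>2" using x end_y_facts unfolding orth_circle_sphere by auto
    obtain v1 v2 where v12: "v = plane_pt v1 v2" using v mem_frame_plane_iff by blast
    have "v1 * (end_x - 1 / end_x) + v2 * \<tau> = 0"
      using v(2) by (simp add: v12 t orthogonal_def plane_pt_simps inner_plane_pt)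
    then have "v1 * (end_x\<^sup>2 - 1) + end_x * v2 * \<tau> = 0"
      using end_x_facts by (simp add: field_simps power2_eq_square)
    moreover have "end_x\<^sup>2 - 1 = - (\<tau> * \<tau>)" using t(2) by (simp add: power2_eq_square)
    ultimately have "\<tau> * (end_x * v2 - \<tau> * v1) = 0"
      by (simp only:) (simp add: algebra_simps)
    moreover have "\<tau> \<noteq> 0" using t(2) end_y_facts by auto
    ultimately have "v = (v1 / end_x) *\<^sub>R x"
      using end_x_facts by (simp add: v12 t plane_pt_simps plane_pt_eq_iff field_simps)
    then show ?thesis using w by (simp add: orthogonal_def inner_commute)
  qed
  then show ?thesis
    unfolding is_orthogonal_circle_def
    using end_x_facts end_y_facts orth_circle_sphere
    by (intro exI[of _ "plane_pt (1 / end_x) 0"] exI[of _ "end_y / end_x"] exI[of _ "span {e1, e2}"] conjI ballI allI impI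
        subspace_span dim_frame_plane orth_circle_def) (simp_all only: divide_pos_pos insert_not_empty not_False_eq_True)
qed

lemma frame_points_independent: "plane_pt A B \<noteq> plane_pt A (- B)" "independent {plane_pt A B, plane_pt A (- B)}"
proof -
  show ne: "plane_pt A B \<noteq> plane_pt A (- B)" using B by (simp add: plane_pt_eq_iff)
  have "plane_pt A b \<notin> span {plane_pt A (- b)}" if "b \<noteq> 0" for b
    using A that by (auto simp: span_singleton plane_pt_simps plane_pt_eq_iff)
  from this[of B] this[of "- B"] show "independent {plane_pt A B, plane_pt A (- B)}"
    using B ne unfolding dependent_def by (auto simp: insert_Diff_if)
qed

lemma frame_points_in_orth_circle: "plane_pt A B \<in> orth_circle" "plane_pt A (- B) \<in> orth_circle"
  using end_x_facts(4) by (auto simp: mem_orth_circle_iff plane_pt_eq_iff)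

lemma noneuclidean_line_orth_circle: "noneuclidean_line (plane_pt A B) (plane_pt A (- B)) = orth_circle"
  unfolding noneuclidean_line_def if_not_P[OF frame_points_independent(2)]
proof (rule the_equality)
  show *: "plane_pt A B \<in> orth_circle \<and> plane_pt A (- B) \<in> orth_circle \<and> is_orthogonal_circle orth_circle"
    by (intro conjI frame_points_in_orth_circle is_orthogonal_circle_orth_circle)
  show "L = orth_circle" if "plane_pt A B \<in> L \<and> plane_pt A (- B) \<in> L \<and> is_orthogonal_circle L" for L
    using that * frame_points_independent by (metis orthogonal_circle_unique)
qed

text \<open>The chord from \<open>(A, B)\<close> to the end \<open>(end_x, - end_y)\<close> meets the circle in no further point and
  separates \<open>(A, - B)\<close> from the other end. The lower arc over \<open>[A, end_x]\<close> joins \<open>(A, - B)\<close> to the end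
  \<open>(end_x, - end_y)\<close> and avoids the two points in the upper half-plane.\<close>

lemma line_ends_orth_circle: "line_ends (plane_pt A B) (plane_pt A (- B)) = (plane_pt end_x (- end_y), plane_pt end_x end_y)"
proof (rule line_ends_eqI[OF noneuclidean_line_orth_circle orth_circle_sphere])
  show "plane_pt A B \<in> orth_circle" "plane_pt A (- B) \<in> orth_circle" by (rule frame_points_in_orth_circle)+
  show "distinct [plane_pt A B, plane_pt A (- B), plane_pt end_x (- end_y), plane_pt end_x end_y]"
    using B end_y_facts end_x_facts by (auto simp: plane_pt_eq_iff)
  show "\<not> connected_component (orth_circle - {plane_pt A B, plane_pt end_x (- end_y)}) (plane_pt A (- B)) (plane_pt end_x end_y)"
  proof (rule not_connected_component_across_hyperplane)
    define k where "k = plane_pt (end_y + B) (end_x - A) \<bullet> plane_pt A B"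
    show "plane_pt (end_y + B) (end_x - A) \<bullet> plane_pt A (- B) < k"
      using B end_x_facts by (simp add: k_def inner_plane_pt algebra_simps)
    have "0 < 2 * end_y * (end_x - A)" using end_y_facts end_x_facts by simp
    then show "k < plane_pt (end_y + B) (end_x - A) \<bullet> plane_pt end_x end_y"
      by (simp add: k_def inner_plane_pt algebra_simps)
    fix z assume z: "z \<in> orth_circle - {plane_pt A B, plane_pt end_x (- end_y)}"
    show "plane_pt (end_y + B) (end_x - A) \<bullet> z \<noteq> k"
    proof
      assume zk: "plane_pt (end_y + B) (end_x - A) \<bullet> z = k"
      obtain s \<tau> where st: "z = plane_pt s \<tau>" "end_x * (s\<^sup>2 + \<tau>\<^sup>2 + 1) = 2 * s" using z mem_orth_circle_iff by auto
      \<comment> \<open>Position of \<open>z\<close> on the chord. The equation of the circle is quadratic in \<open>m\<close> and holds at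
        \<open>m = 0\<close> and \<open>m = 1\<close>, so these are its only roots.\<close>
      define m where "m = (s - A) / (end_x - A)"
      have s: "s = A + m * (end_x - A)" using end_x_facts by (simp add: m_def)
      have "(end_x - A) * (\<tau> - B) = - (s - A) * (end_y + B)"
        using zk by (simp add: st k_def inner_plane_pt algebra_simps)
      then have t: "\<tau> = B - m * (end_y + B)" using end_x_facts by (simp add: m_def field_simps)
      have "end_x * (s\<^sup>2 + \<tau>\<^sup>2 + 1) - 2 * s = end_x * ((end_x - A)\<^sup>2 + (end_y + B)\<^sup>2) * (m * (m - 1))
        + (1 - m) * (end_x * (A\<^sup>2 + B\<^sup>2 + 1) - 2 * A) + m * (end_x * (end_x\<^sup>2 + end_y\<^sup>2 + 1) - 2 * end_x)"
        unfolding s t by (simp add: algebra_simps power2_eq_square)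
      then have "end_x * ((end_x - A)\<^sup>2 + (end_y + B)\<^sup>2) * (m * (m - 1)) = 0"
        unfolding st(2) end_x_facts(4) end_y_facts(2) by simp
      moreover have "0 < (end_x - A)\<^sup>2 + (end_y + B)\<^sup>2"
        using end_x_facts by (intro add_pos_nonneg) auto
      ultimately have "m = 0 \<or> m = 1" using end_x_facts by simp
      then show False using z st s t by auto
    qed
  qed
  show "connected_component (orth_circle - {plane_pt A B, plane_pt end_x end_y}) (plane_pt A (- B)) (plane_pt end_x (- end_y))"
  proof -
    \<comment> \<open>The square of the second coordinate of a point of the circle, as a function of the first.\<close>
    define g where "g = (\<lambda>s. 2 * s / end_x - s\<^sup>2 - 1)"
    define h where "h = (\<lambda>s. plane_pt s (- sqrt (g s)))"
    have gA: "g A = B\<^sup>2" and gp: "g end_x = end_y\<^sup>2"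
    proof -
      have "2 * A / end_x = A\<^sup>2 + B\<^sup>2 + 1"
        unfolding end_x_facts(4)[symmetric] using end_x_facts(1) by simp
      then show "g A = B\<^sup>2" by (simp add: g_def)
      show "g end_x = end_y\<^sup>2" using end_x_facts(1) by (simp add: g_def end_y_facts(2))
    qed
    have pos: "0 < g s" if "s \<in> {A..end_x}" for s
    proof -
      have "s + A \<le> 2" using that end_x_facts by auto
      also have "2 \<le> 2 / end_x" using end_x_facts by (simp add: field_simps)
      finally have "0 \<le> (s - A) * (2 / end_x - s - A)" using that by simp
      also have "\<dots> = g s - g A" by (simp add: g_def algebra_simps power2_eq_square divide_inverse)
      finally show ?thesis using gA B by (metis add_0 diff_ge_0_iff_ge le_less_trans less_le_trans zero_less_power)
    qed
    have "continuous_on {A..end_x} h"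
      unfolding h_def plane_pt_def g_def by (intro continuous_intros) (use end_x_facts in auto)
    then have "connected (h ` {A..end_x})" by (intro connected_continuous_image) auto
    moreover have "h ` {A..end_x} \<subseteq> orth_circle - {plane_pt A B, plane_pt end_x end_y}"
    proof
      fix z assume "z \<in> h ` {A..end_x}"
      then obtain s where s: "s \<in> {A..end_x}" "z = h s" by blast
      have "end_x * (s\<^sup>2 + g s + 1) = 2 * s" using end_x_facts by (simp add: g_def)
      then have "z \<in> orth_circle"
        unfolding s(2) h_def mem_orth_circle_iff using pos[OF s(1)]
        by (intro exI[of _ s] exI[of _ "- sqrt (g s)"]) simp
      moreover have "- sqrt (g s) < 0" using pos[OF s(1)] by simp
      then have "- sqrt (g s) \<noteq> B" "- sqrt (g s) \<noteq> end_y" using B end_y_facts(1) by linarith+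
      then have "z \<noteq> plane_pt A B" "z \<noteq> plane_pt end_x end_y"
        unfolding s(2) h_def plane_pt_eq_iff by blast+
      ultimately show "z \<in> orth_circle - {plane_pt A B, plane_pt end_x end_y}" by simp
    qed
    moreover have "plane_pt A (- B) = h A" "plane_pt end_x (- end_y) = h end_x"
      using B end_y_facts(1) gA gp by (simp_all add: h_def)
    ultimately show ?thesis
      using end_x_facts unfolding connected_component_def by (intro exI[of _ "h ` {A..end_x}"]) auto
  qed
qed

lemma quat_poincare_dist_orth_circle:
  "quat_poincare_dist (plane_pt A B) (plane_pt A (- B)) = artanh (2 * B / sqrt ((1 - (A\<^sup>2 + B\<^sup>2))\<^sup>2 + (2 * B)\<^sup>2))"
proof -
  \<comment> \<open>A rational form of the square root in the claim.\<close>
  define R where "R = (1 + A\<^sup>2 + B\<^sup>2) * end_y"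
  have pos: "0 < 1 + A\<^sup>2 + B\<^sup>2" by (simp add: add_pos_nonneg)
  have R0: "0 < R" using pos end_y_facts by (simp add: R_def)
  have "R\<^sup>2 = (1 + A\<^sup>2 + B\<^sup>2)\<^sup>2 - (end_x * (A\<^sup>2 + B\<^sup>2 + 1))\<^sup>2"
    by (simp add: R_def power_mult_distrib end_y_facts(2) left_diff_distrib add_ac mult.commute)
  also have "\<dots> = (1 - (A\<^sup>2 + B\<^sup>2))\<^sup>2 + (2 * B)\<^sup>2"
    unfolding end_x_facts(4) by (simp add: power2_eq_square algebra_simps)
  finally have R2: "R\<^sup>2 = (1 - (A\<^sup>2 + B\<^sup>2))\<^sup>2 + (2 * B)\<^sup>2" .
  have R: "sqrt ((1 - (A\<^sup>2 + B\<^sup>2))\<^sup>2 + (2 * B)\<^sup>2) = R"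
    unfolding R2[symmetric] using R0 by simp
  have "(2 * B)\<^sup>2 < R\<^sup>2" unfolding R2 using AB by simp
  then have BR: "2 * B < R" by (rule power_less_imp_less_base) (use R0 in simp)
  have sq: "(A - end_x)\<^sup>2 + (B + \<epsilon> * end_y)\<^sup>2 = end_y * (R + \<epsilon> * (2 * B))" if "\<epsilon>\<^sup>2 = 1" for \<epsilon>
  proof -
    have "(A - end_x)\<^sup>2 + (B + \<epsilon> * end_y)\<^sup>2 = A\<^sup>2 + B\<^sup>2 - end_x * (2 * A) + (end_x\<^sup>2 + \<epsilon>\<^sup>2 * end_y\<^sup>2) + \<epsilon> * (2 * B) * end_y"
      by (simp add: power2_eq_square algebra_simps)
    also have "\<dots> = (1 + A\<^sup>2 + B\<^sup>2) * (1 - end_x\<^sup>2) + \<epsilon> * (2 * B) * end_y"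
      unfolding that end_x_facts(4)[symmetric] end_y_facts(2) by (simp add: power2_eq_square algebra_simps)
    also have "\<dots> = end_y * (R + \<epsilon> * (2 * B))"
      unfolding end_y_facts(2)[symmetric] by (simp add: R_def power2_eq_square algebra_simps)
    finally show ?thesis .
  qed
  have s: "(A - end_x)\<^sup>2 + (B + end_y)\<^sup>2 = end_y * (R + 2 * B)" using sq[of 1] by simp
  have d: "(A - end_x)\<^sup>2 + (B - end_y)\<^sup>2 = end_y * (R - 2 * B)" using sq[of "-1"] by simp
  have nz: "(A - end_x)\<^sup>2 + (B - end_y)\<^sup>2 \<noteq> 0" unfolding d using BR end_y_facts by simp
  have "cross_ratio (plane_pt A B) (plane_pt A (- B)) (plane_pt end_x (- end_y)) (plane_pt end_x end_y)
      = plane_pt (A - end_x) (B + end_y) * inverse (plane_pt (A - end_x) (B - end_y)) * plane_pt (A - end_x) (- (B + end_y)) * inverse (plane_pt (A - end_x) (- (B - end_y)))"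
    by (simp add: cross_ratio_def plane_pt_simps)
  also have "\<dots> = of_real ((R + 2 * B) / (R - 2 * B))"
    unfolding frame_cross_ratio[OF nz] s d using end_y_facts by simp
  finally have cr: "cross_ratio (plane_pt A B) (plane_pt A (- B)) (plane_pt end_x (- end_y)) (plane_pt end_x end_y) = of_real ((R + 2 * B) / (R - 2 * B))" .
  have "(1 + 2 * B / R) / (1 - 2 * B / R) = (R + 2 * B) / (R - 2 * B)"
    using R0 BR by (simp add: field_simps)
  then show ?thesis
    unfolding R artanh_def using frame_points_independent(1)
    by (simp add: quat_poincare_dist_def line_ends_orth_circle cr del: of_real_divide of_real_add of_real_diff)
qed

end

end

text \<open>On a sphere about the origin the distance depends on the chord alone. This also covers antipodal
  points, where the non-Euclidean line is a diameter and not a circle.\<close>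

lemma quat_poincare_dist_equal_norms:
  assumes x: "norm x = t" and y: "norm y = t" and t: "t < 1"
  shows "quat_poincare_dist x y = artanh (dist x y / sqrt ((1 - t\<^sup>2)\<^sup>2 + (dist x y)\<^sup>2))"
proof -
  consider "x = y" | "x \<noteq> y" "x + y = 0" | "x \<noteq> y" "x + y \<noteq> 0" by blast
  then show ?thesis
  proof cases
    case 1
    then show ?thesis by (simp add: quat_poincare_dist_def)
  next
    case 2
    then have xy: "y = - x" by (simp add: eq_neg_iff_add_eq_0 add.commute)
    have t0: "0 < t" using 2 x xy by auto
    have d: "dist x y = 2 * t"
      using x by (simp add: xy dist_norm flip: scaleR_2)
    have "(1 - t\<^sup>2)\<^sup>2 + (2 * t)\<^sup>2 = (1 + t\<^sup>2)\<^sup>2" by (simp add: power2_eq_square algebra_simps)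
    then have r: "sqrt ((1 - t\<^sup>2)\<^sup>2 + (dist x y)\<^sup>2) = 1 + t\<^sup>2" unfolding d by simp
    have "quat_poincare_dist ((- t) *\<^sub>R (- sgn x)) (t *\<^sub>R (- sgn x)) = artanh ((t - (- t)) / (1 - (- t) * t))"
      using 2 xy t t0 by (intro quat_poincare_dist_diameter) (auto simp: norm_sgn)
    moreover have "(- t) *\<^sub>R (- sgn x) = x" "t *\<^sub>R (- sgn x) = y"
      using x t0 xy by (auto simp: sgn_div_norm)
    ultimately show ?thesis unfolding r by (simp add: d power2_eq_square)
  next
    case 3
    define A B where "A = norm (x + y) / 2" and "B = norm (x - y) / 2"
    define e1 e2 where "e1 = sgn (x + y)" and "e2 = sgn (x - y)"
    have xx: "x \<bullet> x = t\<^sup>2" "y \<bullet> y = t\<^sup>2" using x y by (auto simp flip: power2_norm_eq_inner)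
    have e: "norm e1 = 1" "norm e2 = 1" "e1 \<bullet> e2 = 0"
      using 3 by (auto simp: e1_def e2_def norm_sgn sgn_div_norm inner_diff inner_add inner_commute xx)
    have ae: "A *\<^sub>R e1 = (1 / 2) *\<^sub>R (x + y)" "B *\<^sub>R e2 = (1 / 2) *\<^sub>R (x - y)"
      using 3 by (simp_all add: A_def B_def e1_def e2_def sgn_div_norm)
    have "x = A *\<^sub>R e1 + B *\<^sub>R e2" "y = A *\<^sub>R e1 + (- B) *\<^sub>R e2"
      unfolding scaleR_minus_left ae by (simp_all add: scaleR_add_right scaleR_diff_right flip: scaleR_left_distrib)
    then have xy: "x = plane_pt e1 e2 A B" "y = plane_pt e1 e2 A (- B)"
      by (simp_all add: plane_pt_def[OF e])
    have "A\<^sup>2 + B\<^sup>2 = t\<^sup>2"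
      by (simp add: A_def B_def power_divide power2_norm_eq_inner inner_add inner_diff xx inner_commute field_simps)
    moreover have "t\<^sup>2 < 1" using t x by (auto simp: abs_square_less_1)
    moreover have "0 < A" "0 < B" using 3 by (auto simp: A_def B_def)
    ultimately have "quat_poincare_dist x y = artanh (2 * B / sqrt ((1 - t\<^sup>2)\<^sup>2 + (2 * B)\<^sup>2))"
      using quat_poincare_dist_orth_circle[OF e, of A B] unfolding xy by simp
    moreover have "dist x y = 2 * B" by (simp add: B_def dist_norm)
    ultimately show ?thesis by simp
  qed
qed

section \<open>The two distances are not isometric\<close>

lemma dist_from_artanh_eq:
  fixes D \<sigma> N :: real
  assumes D: "0 \<le> D" and \<sigma>: "0 < \<sigma>" and N: "\<sigma> \<le> N"
    and eq: "artanh (D / sqrt (\<sigma>\<^sup>2 + D\<^sup>2)) = artanh (sqrt (1 - \<sigma>\<^sup>2 / N\<^sup>2))"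
  shows "D\<^sup>2 = N\<^sup>2 - \<sigma>\<^sup>2"
proof -
  have pos: "0 < \<sigma>\<^sup>2 + D\<^sup>2" using \<sigma> by (simp add: add_pos_nonneg)
  have N2: "\<sigma>\<^sup>2 \<le> N\<^sup>2" "0 < N\<^sup>2" using N \<sigma> by (auto intro: power_mono)
  have sq: "(D / sqrt (\<sigma>\<^sup>2 + D\<^sup>2))\<^sup>2 = 1 - \<sigma>\<^sup>2 / (\<sigma>\<^sup>2 + D\<^sup>2)"
  proof -
    have "(\<sigma>\<^sup>2 + D\<^sup>2) / (\<sigma>\<^sup>2 + D\<^sup>2) = 1" using pos by (metis divide_self less_irrefl)
    moreover have "(sqrt (\<sigma>\<^sup>2 + D\<^sup>2))\<^sup>2 = \<sigma>\<^sup>2 + D\<^sup>2" using pos by simp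
    ultimately show ?thesis unfolding add_divide_distrib power_divide by simp
  qed
  have sq': "(sqrt (1 - \<sigma>\<^sup>2 / N\<^sup>2))\<^sup>2 = 1 - \<sigma>\<^sup>2 / N\<^sup>2"
    using N2 by simp
  have "\<bar>D / sqrt (\<sigma>\<^sup>2 + D\<^sup>2)\<bar> < 1"
    unfolding abs_square_less_1[symmetric] sq using pos \<sigma> by simp
  moreover have "\<bar>sqrt (1 - \<sigma>\<^sup>2 / N\<^sup>2)\<bar> < 1"
    unfolding abs_square_less_1[symmetric] sq' using N2 \<sigma> by simp
  ultimately have "D / sqrt (\<sigma>\<^sup>2 + D\<^sup>2) = sqrt (1 - \<sigma>\<^sup>2 / N\<^sup>2)"
    using eq by (simp only: artanh_real_eq_iff)
  then have "\<sigma>\<^sup>2 / (\<sigma>\<^sup>2 + D\<^sup>2) = \<sigma>\<^sup>2 / N\<^sup>2"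
    using sq sq' by auto
  then show ?thesis using pos N2 \<sigma> by (simp add: frac_eq_eq)
qed

text \<open>An isometry that fixes the origin maps spheres about the origin to spheres of the same radius, and
  there each of the two distances is a function of a single quantity: the chord on the quaternionic
  side, \<open>\<bar>1 - \<langle>z', z\<rangle>\<bar>\<close> on the complex side. Equating the two functions expresses one quantity through
  the other.\<close>

lemma dist_of_centred_isometry:
  fixes F :: "complex ^ 'n \<Rightarrow> quat"
  assumes F: "\<And>z. z \<in> ball 0 1 \<Longrightarrow> F z \<in> ball 0 1" "F 0 = 0"
    and iso: "\<And>z z'. z \<in> ball 0 1 \<Longrightarrow> z' \<in> ball 0 1 \<Longrightarrow>
      quat_poincare_dist (F z) (F z') = kobayashi_dist (ball 0 1) z z'"
    and z: "norm z = t" "norm z' = t" "t < 1"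
  shows "norm (F z) = t" and "(dist (F z) (F z'))\<^sup>2 = (cmod (1 - hermitian_product z' z))\<^sup>2 - (1 - t\<^sup>2)\<^sup>2"
proof -
  have norm_F: "norm (F y) = norm y" if "y \<in> ball 0 1" for y
  proof -
    have "artanh (norm (F y)) = artanh (norm y)"
      using iso[of 0 y] quat_poincare_dist_0[OF F(1)[OF that]] kobayashi_ball_0(2)[OF that] that
      by (simp add: F(2))
    then show ?thesis
      using that F(1)[OF that] by (simp add: artanh_real_eq_iff)
  qed
  have zb: "z \<in> ball 0 1" "z' \<in> ball 0 1" using z by auto
  show n: "norm (F z) = t" using norm_F[OF zb(1)] z by simp
  have n': "norm (F z') = t" using norm_F[OF zb(2)] z by simp
  have "0 \<le> t" using z(1) by auto
  then have t2: "t\<^sup>2 < 1" using z(3) by (simp add: abs_square_less_1)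
  have "cmod (hermitian_product z' z) \<le> t\<^sup>2"
    using norm_hermitian_product_le[of z' z] z by (simp add: power2_eq_square)
  then have N: "1 - t\<^sup>2 \<le> cmod (1 - hermitian_product z' z)"
    using norm_triangle_ineq2[of 1 "hermitian_product z' z"] by simp
  have "artanh (dist (F z) (F z') / sqrt ((1 - t\<^sup>2)\<^sup>2 + (dist (F z) (F z'))\<^sup>2)) =
      artanh (sqrt (1 - (1 - t\<^sup>2)\<^sup>2 / (cmod (1 - hermitian_product z' z))\<^sup>2))"
    using iso[OF zb] kobayashi_dist_ball[OF zb] quat_poincare_dist_equal_norms[OF n n' z(3)]
    by (simp add: z power2_eq_square[of "1 - t\<^sup>2"])
  then show "(dist (F z) (F z'))\<^sup>2 = (cmod (1 - hermitian_product z' z))\<^sup>2 - (1 - t\<^sup>2)\<^sup>2"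
    using t2 N by (intro dist_from_artanh_eq) auto
qed

theorem theorem1p11:
  shows "\<not> isometric_spaces
           (ball (0 :: quat) 1) quat_poincare_dist
           (ball (0 :: complex ^ 2) 1) (kobayashi_dist (ball 0 1))"
proof
  assume "isometric_spaces (ball (0 :: quat) 1) quat_poincare_dist
           (ball (0 :: complex ^ 2) 1) (kobayashi_dist (ball 0 1))"
  then obtain f where bij: "bij_betw f (ball (0 :: quat) 1) (ball (0 :: complex ^ 2) 1)"
    and iso: "\<And>x y. x \<in> ball 0 1 \<Longrightarrow> y \<in> ball 0 1 \<Longrightarrow>
      kobayashi_dist (ball 0 1) (f x) (f y) = quat_poincare_dist x y"
    unfolding isometric_spaces_def by blast
  define w where "w = f 0"
  have w: "w \<in> ball 0 1" unfolding w_def using bij by (rule bij_betw_apply) simp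
  \<comment> \<open>The inverse isometry, after an automorphism of the complex ball has made it fix the origin.\<close>
  define F where "F = (\<lambda>z. inv_into (ball 0 1) f (ball_involution w z))"
  have F: "F z \<in> ball 0 1" "f (F z) = ball_involution w z" if "z \<in> ball 0 1" for z
  proof -
    have "ball_involution w z \<in> f ` ball 0 1"
      using ball_involution_in_ball[OF w that] bij by (simp only: bij_betw_imp_surj_on)
    then show "F z \<in> ball 0 1" "f (F z) = ball_involution w z"
      unfolding F_def by (rule inv_into_into, rule f_inv_into_f)
  qed
  have F0: "F 0 = 0"
    unfolding F_def ball_involution_0[OF w] unfolding w_def
    by (rule bij_betw_inv_into_left[OF bij]) simp
  have isoF: "quat_poincare_dist (F z) (F z') = kobayashi_dist (ball 0 1) z z'"
    if "z \<in> ball 0 1" "z' \<in> ball 0 1" for z z'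
    using iso[OF F(1)[OF that(1)] F(1)[OF that(2)]] kobayashi_dist_ball_involution[OF w that]
    by (simp only: F(2)[OF that(1)] F(2)[OF that(2)])
  have chord: "norm (F z) = 1 / 2"
    "(dist (F z) (F z'))\<^sup>2 = (cmod (1 - hermitian_product z' z))\<^sup>2 - (1 - (1 / 2)\<^sup>2)\<^sup>2"
    if "norm z = 1 / 2" "norm z' = 1 / 2" for z z'
    using dist_of_centred_isometry[of F z "1 / 2" z', OF _ F0 _ that] F(1) isoF by simp_all
  \<comment> \<open>\<open>Q\<close> is equidistant from \<open>P\<close> and \<open>- P\<close>, and it lies in a complex direction orthogonal to \<open>P\<close>.\<close>
  define P Q :: "complex ^ 2" where "P = axis 1 (1 / 2)" and "Q = axis 2 (1 / 2)"
  have nP: "norm P = 1 / 2" "norm (- P) = 1 / 2" "norm Q = 1 / 2"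
    by (simp_all add: P_def Q_def norm_vec_def L2_set_def sum_2 axis_def)
  have h: "hermitian_product P P = 1 / 4" "hermitian_product Q P = 0"
    by (simp_all add: P_def Q_def hermitian_product_def sum_2 axis_def)
  have n: "norm (F P) = 1 / 2" "norm (F (- P)) = 1 / 2" "norm (F Q) = 1 / 2"
    using chord(1)[OF nP(1,1)] chord(1)[OF nP(2,2)] chord(1)[OF nP(3,3)] by auto
  have ab: "(dist (F P) (F (- P)))\<^sup>2 = 1"
    using chord(2)[OF nP(1,2)] by (simp add: h power2_eq_square)
  have ac: "(dist (F P) (F Q))\<^sup>2 = 7 / 16" and bc: "(dist (F (- P)) (F Q))\<^sup>2 = 7 / 16"
    using chord(2)[OF nP(1,3)] chord(2)[OF nP(2,3)] by (simp_all add: h power2_eq_square)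
  have sq: "(norm (F P))\<^sup>2 = 1 / 4" "(norm (F (- P)))\<^sup>2 = 1 / 4" "(norm (F Q))\<^sup>2 = 1 / 4"
    unfolding n by (simp_all add: power2_eq_square)
  \<comment> \<open>The chord from \<open>F P\<close> to \<open>F (- P)\<close> is as long as the diameter of the sphere.\<close>
  have "(norm (F P + F (- P)))\<^sup>2 = 0"
    using ab sq unfolding dist_norm power2_norm_eq_inner by (simp add: inner_add inner_diff inner_commute)
  then have "F (- P) = - F P" by (simp add: eq_neg_iff_add_eq_0 add.commute)
  \<comment> \<open>Thales: the chords from a third point to two antipodal points form a right angle.\<close>
  then have "(dist (F P) (F Q))\<^sup>2 + (dist (F (- P)) (F Q))\<^sup>2 = 1"
    using sq unfolding dist_norm power2_norm_eq_inner by (simp add: inner_diff inner_commute)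
  then show False using ac bc by simp
qed

end
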